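(* Let $n\geq 3$ be a natural number, $R$ a commutative ring and $H$ a subgroup of $GL_n(R)$. Then $H$ is normalized by $E_n(R)$ if and only if $$E_n(R,I)\subseteq H\subseteq C_n(R,I)$$ for some ideal $I$ of $R$.
   Context: Rings are associative with $1\neq 0$. $GL_n(R)$ is the group of invertible $n\times n$ matrices over $R$. Let $e$ be the identity matrix and $e^{ij}$ the matrix with $1$ at position $(i,j)$ and zeros elsewhere. For $i\neq j$ and $x\in R$, $t_{ij}(x):=e+xe^{ij}$ is an elementary transvection. $E_n(R)$ is the subgroup of $GL_n(R)$ generated by all elementary transvections. For an ideal $I$ of $R$, $E_n(I)$ is the subgroup generated by all $t_{ij}(x)$ with $i\neq j$ and $x\in I$, and $E_n(R,I)$ is the normal closure of $E_n(I)$ in $E_n(R)$. $C_n(R,I)$ (the full congruence subgroup of level $I$) is the preimage of the center of $GL_n(R/I)$ under the group homomorphism $GL_n(R)\to GL_n(R/I)$ induced by the canonical map $R\to R/I$; the ideal $I=R$ is allowed, in which case $GL_n(R/I)$ is the trivial group and $C_n(R,R)=GL_n(R)$. *)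

theory Defs
  imports
    "HOL-Algebra.Algebra"
    "Jordan_Normal_Form.Matrix"
begin

text \<open>
  Groups and rings follow HOL-Algebra, so that the quotient ring \<open>R Quot I\<close> is a ring like any
  other. The matrix type of Jordan_Normal_Form only serves as a container for the entries:
  its own arithmetic belongs to type-class rings, whereas multiplication and identity below use the
  operations of \<open>R\<close>. Row and column indices range over \<open>0, \<dots>, n - 1\<close>.
\<close>

definition matrix_monoid :: "nat \<Rightarrow> ('a, 'b) ring_scheme \<Rightarrow> 'a mat monoid" where
  "matrix_monoid n R =
    \<lparr>carrier = {A \<in> carrier_mat n n. elements_mat A \<subseteq> carrier R},
     monoid.mult = (\<lambda>A B. mat n n (\<lambda>(i, j). \<Oplus>\<^bsub>R\<^esub>k\<in>{..<n}. A $$ (i, k) \<otimes>\<^bsub>R\<^esub> B $$ (k, j))),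
     one = mat n n (\<lambda>(i, j). if i = j then \<one>\<^bsub>R\<^esub> else \<zero>\<^bsub>R\<^esub>)\<rparr>"

definition GL :: "nat \<Rightarrow> ('a, 'b) ring_scheme \<Rightarrow> 'a mat monoid" where
  "GL n R = units_of (matrix_monoid n R)"

definition transvection :: "nat \<Rightarrow> ('a, 'b) ring_scheme \<Rightarrow> nat \<Rightarrow> nat \<Rightarrow> 'a \<Rightarrow> 'a mat" where
  "transvection n R i j x =
    mat n n (\<lambda>(k, l). (if k = l then \<one>\<^bsub>R\<^esub> else \<zero>\<^bsub>R\<^esub>)
      \<oplus>\<^bsub>R\<^esub> (if k = i \<and> l = j then x else \<zero>\<^bsub>R\<^esub>))"

text \<open>\<open>elementary_group n R I\<close> is $E_n(I)$; the group $E_n(R)$ is the case \<open>I = carrier R\<close>.\<close>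

definition elementary_group :: "nat \<Rightarrow> ('a, 'b) ring_scheme \<Rightarrow> 'a set \<Rightarrow> 'a mat set" where
  "elementary_group n R I =
    generate (GL n R) {transvection n R i j x | i j x. i < n \<and> j < n \<and> i \<noteq> j \<and> x \<in> I}"

definition normal_closure :: "('a, 'b) monoid_scheme \<Rightarrow> 'a set \<Rightarrow> 'a set" where
  "normal_closure G A = \<Inter>{N. N \<lhd> G \<and> A \<subseteq> N}"

text \<open>The normal closure is taken inside $E_n(R)$, not inside $GL_n(R)$.\<close>

definition relative_elementary_group ::
    "nat \<Rightarrow> ('a, 'b) ring_scheme \<Rightarrow> 'a set \<Rightarrow> 'a mat set" where
  "relative_elementary_group n R I =
    normal_closure ((GL n R)\<lparr>carrier := elementary_group n R (carrier R)\<rparr>) (elementary_group n R I)"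

definition group_center :: "('a, 'b) monoid_scheme \<Rightarrow> 'a set" where
  "group_center G = {z \<in> carrier G. \<forall>g \<in> carrier G. z \<otimes>\<^bsub>G\<^esub> g = g \<otimes>\<^bsub>G\<^esub> z}"

definition full_congruence_subgroup ::
    "nat \<Rightarrow> ('a, 'b) ring_scheme \<Rightarrow> 'a set \<Rightarrow> 'a mat set" where
  "full_congruence_subgroup n R I =
    {A \<in> carrier (GL n R). map_mat (\<lambda>x. I +>\<^bsub>R\<^esub> x) A \<in> group_center (GL n (R Quot I))}"

end

theory Submission
  imports Defs
begin

text \<open>
  Everything is computed with the matrices \<open>dyad v w = e + v w\<close>, where \<open>w v = 0\<close>: conjugation by
  \<open>\<sigma>\<close> turns \<open>dyad v w\<close> into \<open>dyad (\<sigma> v) (w \<sigma>\<^sup>-\<^sup>1)\<close>, and two of them sharing a side multiply by adding the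
  other side.

  If \<open>E\<^sub>n(R)\<close> normalizes \<open>H\<close>, the \<open>x\<close> with all \<open>t\<^sub>i\<^sub>j(x) \<in> H\<close> form an ideal. Given \<open>\<sigma> \<in> H\<close> and
  distinct \<open>i, j, k\<close>, the column \<open>a = - \<sigma>\<^sub>i\<^sub>j e\<^sub>i + \<sigma>\<^sub>i\<^sub>i e\<^sub>j\<close> is chosen so that \<open>(\<sigma> a)\<^sub>i = 0\<close>;
  three commutators starting from \<open>\<sigma>\<close> and \<open>e + a e\<^sub>k\<close> then yield \<open>t\<^sub>j\<^sub>i(- \<sigma>\<^sub>i\<^sub>j) \<in> H\<close>. Conjugating by
  \<open>t\<^sub>i\<^sub>j(1)\<close> brings \<open>\<sigma>\<^sub>i\<^sub>i - \<sigma>\<^sub>j\<^sub>j\<close> to position \<open>(i, j)\<close>.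

  Conversely, let \<open>\<sigma> \<in> C\<^sub>n(R, I)\<close>; it suffices that \<open>\<sigma> t\<^sub>i\<^sub>j(x) \<sigma>\<^sup>-\<^sup>1 \<in> E\<^sub>n(R, I) t\<^sub>i\<^sub>j(x)\<close>. The left-hand side
  is \<open>e + x v w\<close> with \<open>v\<close> the \<open>i\<close>-th column of \<open>\<sigma>\<close> and \<open>w\<close> the \<open>j\<close>-th row of \<open>\<sigma>\<^sup>-\<^sup>1\<close>. With
  \<open>u\<close> the \<open>i\<close>-th row of \<open>\<sigma>\<^sup>-\<^sup>1\<close> we have \<open>u v = 1\<close>, \<open>w v = 0\<close>, so (Suslin)
  \<open>w = \<Sum> w\<^sub>k u\<^sub>l (v\<^sub>l e\<^sub>k - v\<^sub>k e\<^sub>l)\<close>. All coefficients except the one for \<open>(k, l) = (j, i)\<close> lie in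
  \<open>I\<close> and contribute factors in \<open>E\<^sub>n(R, I)\<close>; the remaining factor is a commutator congruent to
  \<open>t\<^sub>i\<^sub>j(x)\<close>.
\<close>

section \<open>Matrices of the form e + v w\<close>

text \<open>Interchanging two finite sums is what makes the product of a row, a matrix and a column
  associative, see \<open>dot_mat\<close>.\<close>

lemma (in abelian_monoid) finsum_swap:
  assumes "finite A" "finite B" "\<And>i j. i \<in> A \<Longrightarrow> j \<in> B \<Longrightarrow> f i j \<in> carrier G"
  shows "(\<Oplus>i\<in>A. \<Oplus>j\<in>B. f i j) = (\<Oplus>j\<in>B. \<Oplus>i\<in>A. f i j)"
  using assms(1,3)
proof (induction A rule: finite_induct)
  case empty
  then show ?case by simp
next
  case (insert a A)
  have "(\<Oplus>i\<in>insert a A. \<Oplus>j\<in>B. f i j) = (\<Oplus>j\<in>B. f a j) \<oplus> (\<Oplus>i\<in>A. \<Oplus>j\<in>B. f i j)"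
    using insert by (intro finsum_insert) (auto intro!: finsum_closed)
  also have "\<dots> = (\<Oplus>j\<in>B. f a j) \<oplus> (\<Oplus>j\<in>B. \<Oplus>i\<in>A. f i j)"
    using insert by auto
  also have "\<dots> = (\<Oplus>j\<in>B. f a j \<oplus> (\<Oplus>i\<in>A. f i j))"
    using insert by (intro finsum_addf[symmetric]) (auto intro!: finsum_closed)
  also have "\<dots> = (\<Oplus>j\<in>B. \<Oplus>i\<in>insert a A. f i j)"
    using insert by (intro finsum_cong') (auto intro!: finsum_closed finsum_insert[symmetric])
  finally show ?case .
qed

locale cring_matrix = cring R for R (structure) + fixes n :: nat
begin

abbreviation "G \<equiv> GL n R"
abbreviation "M \<equiv> matrix_monoid n R"
text \<open>Row and column vectors are functions on all naturals that are constrained only below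
  \<open>n\<close>: a row \<open>A $$ (i, k)\<close> is unspecified for \<open>k\<close> out of
  range. Equality of vectors is therefore only used below \<open>n\<close>, through
  \<open>dot_cong\<close> and \<open>dyad_cong\<close>.\<close>

abbreviation "V \<equiv> {..<n} \<rightarrow> carrier R"

definition dot :: "(nat \<Rightarrow> 'a) \<Rightarrow> (nat \<Rightarrow> 'a) \<Rightarrow> 'a" where
  "dot w v = (\<Oplus>k\<in>{..<n}. w k \<otimes> v k)"

definition axis :: "nat \<Rightarrow> 'a \<Rightarrow> nat \<Rightarrow> 'a" where
  "axis i x = (\<lambda>k. if k = i then x else \<zero>)"

definition mat_vec :: "'a mat \<Rightarrow> (nat \<Rightarrow> 'a) \<Rightarrow> nat \<Rightarrow> 'a" where
  "mat_vec A v = (\<lambda>i. dot (\<lambda>k. A $$ (i, k)) v)"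

definition vec_mat :: "(nat \<Rightarrow> 'a) \<Rightarrow> 'a mat \<Rightarrow> nat \<Rightarrow> 'a" where
  "vec_mat w A = (\<lambda>j. dot w (\<lambda>k. A $$ (k, j)))"

definition dyad :: "(nat \<Rightarrow> 'a) \<Rightarrow> (nat \<Rightarrow> 'a) \<Rightarrow> 'a mat" where
  "dyad v w = mat n n (\<lambda>(i, j). (if i = j then \<one> else \<zero>) \<oplus> v i \<otimes> w j)"

lemma axis_apply: "axis i x k = (if k = i then x else \<zero>)"
  by (simp add: axis_def)

lemma dot_closed [simp, intro]: "\<lbrakk>w \<in> V; v \<in> V\<rbrakk> \<Longrightarrow> dot w v \<in> carrier R"
  unfolding dot_def by (auto simp: Pi_iff intro!: finsum_closed)

lemma dot_cong: "\<lbrakk>w' \<in> V; v' \<in> V; \<And>k. k < n \<Longrightarrow> w k = w' k; \<And>k. k < n \<Longrightarrow> v k = v' k\<rbrakk> \<Longrightarrow> dot w v = dot w' v'"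
  unfolding dot_def by (auto simp: Pi_iff intro!: finsum_cong')

lemma dot_comm: "\<lbrakk>w \<in> V; v \<in> V\<rbrakk> \<Longrightarrow> dot w v = dot v w"
  unfolding dot_def by (auto simp: Pi_iff m_comm intro!: finsum_cong')

lemma dot_add: "\<lbrakk>w \<in> V; u \<in> V; v \<in> V\<rbrakk> \<Longrightarrow> dot w (\<lambda>k. u k \<oplus> v k) = dot w u \<oplus> dot w v"
  unfolding dot_def by (subst finsum_addf[symmetric]) (auto simp: Pi_iff r_distr simp del: finsum_addf intro!: finsum_cong')

lemma dot_smult: "\<lbrakk>w \<in> V; v \<in> V; x \<in> carrier R\<rbrakk> \<Longrightarrow> dot w (\<lambda>k. x \<otimes> v k) = x \<otimes> dot w v"
  unfolding dot_def by (subst finsum_rdistr) (auto simp: Pi_iff m_lcomm intro!: finsum_cong')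

lemma dot_axis: "\<lbrakk>w \<in> V; i < n; x \<in> carrier R\<rbrakk> \<Longrightarrow> dot w (axis i x) = w i \<otimes> x"
proof -
  assume a: "w \<in> V" "i < n" "x \<in> carrier R"
  have "dot w (axis i x) = (\<Oplus>k\<in>{..<n}. if i = k then w k \<otimes> x else \<zero>)"
    unfolding dot_def axis_def using a by (intro finsum_cong') (auto simp: Pi_iff)
  also have "\<dots> = w i \<otimes> x"
    using a by (subst finsum_singleton) (auto simp: Pi_iff)
  finally show ?thesis .
qed

lemma axis_closed [simp, intro]: "x \<in> carrier R \<Longrightarrow> axis i x \<in> V"
  by (auto simp: axis_def)

lemma axis_in [simp, intro]: "x \<in> carrier R \<Longrightarrow> axis i x k \<in> carrier R"
  by (auto simp: axis_def)

lemma dot_axis_left: "\<lbrakk>w \<in> V; i < n; x \<in> carrier R\<rbrakk> \<Longrightarrow> dot (axis i x) w = x \<otimes> w i"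
  using dot_axis[of w i x] by (simp add: dot_comm m_comm Pi_iff)

lemma dot_add_left: "\<lbrakk>w \<in> V; u \<in> V; v \<in> V\<rbrakk> \<Longrightarrow> dot (\<lambda>k. u k \<oplus> v k) w = dot u w \<oplus> dot v w"
  using dot_add[of w u v] by (simp add: dot_comm Pi_iff)

lemma dot_smult_left: "\<lbrakk>w \<in> V; v \<in> V; x \<in> carrier R\<rbrakk> \<Longrightarrow> dot (\<lambda>k. x \<otimes> v k) w = x \<otimes> dot v w"
  using dot_smult[of w v x] by (simp add: dot_comm Pi_iff)

section \<open>The matrix monoid and its group of units\<close>

lemma mat_memI: "A \<in> carrier_mat n n \<Longrightarrow> (\<And>i j. i < n \<Longrightarrow> j < n \<Longrightarrow> A $$ (i, j) \<in> carrier R) \<Longrightarrow> A \<in> carrier M"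
  by (auto simp: matrix_monoid_def elements_mat_def)

lemma mat_memD:
  assumes "A \<in> carrier M"
  shows "A \<in> carrier_mat n n" "dim_row A = n" "dim_col A = n" "\<And>i j. i < n \<Longrightarrow> j < n \<Longrightarrow> A $$ (i, j) \<in> carrier R"
proof -
  have A: "A \<in> carrier_mat n n" "elements_mat A \<subseteq> carrier R"
    using assms by (simp_all add: matrix_monoid_def)
  then show "A \<in> carrier_mat n n" "dim_row A = n" "dim_col A = n" by auto
  then show "\<And>i j. i < n \<Longrightarrow> j < n \<Longrightarrow> A $$ (i, j) \<in> carrier R"
    using A by (auto intro: elements_matI subsetD[OF A(2)])
qed

lemma mult_entry: "\<lbrakk>i < n; j < n\<rbrakk> \<Longrightarrow> (A \<otimes>\<^bsub>M\<^esub> B) $$ (i, j) = dot (\<lambda>k. A $$ (i, k)) (\<lambda>k. B $$ (k, j))"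
  by (simp add: matrix_monoid_def dot_def)

lemma one_entry: "\<lbrakk>i < n; j < n\<rbrakk> \<Longrightarrow> \<one>\<^bsub>M\<^esub> $$ (i, j) = (if i = j then \<one> else \<zero>)"
  by (simp add: matrix_monoid_def)

lemma mult_dim: "dim_row (A \<otimes>\<^bsub>M\<^esub> B) = n" "dim_col (A \<otimes>\<^bsub>M\<^esub> B) = n" "A \<otimes>\<^bsub>M\<^esub> B \<in> carrier_mat n n"
  by (simp_all add: matrix_monoid_def)

lemma one_dim: "dim_row \<one>\<^bsub>M\<^esub> = n" "dim_col \<one>\<^bsub>M\<^esub> = n" "\<one>\<^bsub>M\<^esub> \<in> carrier_mat n n"
  by (simp_all add: matrix_monoid_def)

lemma row_closed [intro]: "A \<in> carrier M \<Longrightarrow> i < n \<Longrightarrow> (\<lambda>k. A $$ (i, k)) \<in> V"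
  and col_closed [intro]: "A \<in> carrier M \<Longrightarrow> i < n \<Longrightarrow> (\<lambda>k. A $$ (k, i)) \<in> V"
  by (auto simp: Pi_iff mat_memD(4))

lemma mat_vec_closed [intro]: "A \<in> carrier M \<Longrightarrow> v \<in> V \<Longrightarrow> mat_vec A v \<in> V"
  and vec_mat_closed [intro]: "A \<in> carrier M \<Longrightarrow> v \<in> V \<Longrightarrow> vec_mat v A \<in> V"
  unfolding mat_vec_def vec_mat_def by (auto simp: Pi_iff mat_memD(4) intro!: dot_closed)

text \<open>Two finite sums are interchanged. This one identity gives associativity of the matrix
  product, and later moves a matrix across a pairing with a row of its inverse.\<close>

lemma dot_mat:
  assumes "A \<in> carrier M" "w \<in> V" "v \<in> V"
  shows "dot (vec_mat w A) v = dot w (mat_vec A v)"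
proof -
  have "dot (vec_mat w A) v = (\<Oplus>j\<in>{..<n}. \<Oplus>k\<in>{..<n}. w k \<otimes> A $$ (k, j) \<otimes> v j)"
    unfolding dot_def vec_mat_def using assms mat_memD(4)[OF assms(1)]
    by (intro finsum_cong' finsum_ldistr) (auto simp: Pi_iff intro!: finsum_closed)
  also have "\<dots> = (\<Oplus>k\<in>{..<n}. \<Oplus>j\<in>{..<n}. w k \<otimes> A $$ (k, j) \<otimes> v j)"
    using assms mat_memD(4)[OF assms(1)] by (intro finsum_swap) (auto simp: Pi_iff)
  also have "\<dots> = (\<Oplus>k\<in>{..<n}. w k \<otimes> (\<Oplus>j\<in>{..<n}. A $$ (k, j) \<otimes> v j))"
    using assms mat_memD(4)[OF assms(1)]
    by (intro finsum_cong' refl, simp_all add: Pi_iff finsum_closed)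
       (subst finsum_rdistr, auto simp: Pi_iff m_assoc intro!: finsum_cong')
  finally show ?thesis
    by (simp add: dot_def mat_vec_def)
qed

lemma M_eqI: "\<lbrakk>A \<in> carrier_mat n n; B \<in> carrier_mat n n; \<And>i j. \<lbrakk>i < n; j < n\<rbrakk> \<Longrightarrow> A $$ (i, j) = B $$ (i, j)\<rbrakk> \<Longrightarrow> A = B"
  by (intro eq_matI) (simp_all only: carrier_matD)

lemma row_one: "i < n \<Longrightarrow> k < n \<Longrightarrow> \<one>\<^bsub>M\<^esub> $$ (i, k) = axis i \<one> k"
  by (simp add: one_entry axis_def)

lemma col_one: "i < n \<Longrightarrow> k < n \<Longrightarrow> \<one>\<^bsub>M\<^esub> $$ (k, i) = axis i \<one> k"
  by (simp add: one_entry axis_def)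

lemma monoid_M: "monoid M"
proof
  fix A B assume "A \<in> carrier M" "B \<in> carrier M"
  then show "A \<otimes>\<^bsub>M\<^esub> B \<in> carrier M"
    by (intro mat_memI) (simp_all add: mult_entry mult_dim dot_closed row_closed col_closed)
next
  show "\<one>\<^bsub>M\<^esub> \<in> carrier M"
    by (intro mat_memI) (auto simp: one_entry one_dim)
next
  fix A B C assume a: "A \<in> carrier M" "B \<in> carrier M" "C \<in> carrier M"
  show "A \<otimes>\<^bsub>M\<^esub> B \<otimes>\<^bsub>M\<^esub> C = A \<otimes>\<^bsub>M\<^esub> (B \<otimes>\<^bsub>M\<^esub> C)"
  proof (rule M_eqI)
    fix i j assume ij: "i < n" "j < n"
    have "(A \<otimes>\<^bsub>M\<^esub> B \<otimes>\<^bsub>M\<^esub> C) $$ (i, j) = dot (vec_mat (\<lambda>k. A $$ (i, k)) B) (\<lambda>k. C $$ (k, j))"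
      using ij a unfolding mult_entry[OF ij]
      by (intro dot_cong vec_mat_closed) (simp_all add: Pi_iff mat_memD(4) mult_entry vec_mat_def)
    also have "\<dots> = dot (\<lambda>k. A $$ (i, k)) (mat_vec B (\<lambda>k. C $$ (k, j)))"
      using ij a by (intro dot_mat row_closed col_closed)
    also have "\<dots> = (A \<otimes>\<^bsub>M\<^esub> (B \<otimes>\<^bsub>M\<^esub> C)) $$ (i, j)"
      using ij a unfolding mult_entry[OF ij]
      by (intro dot_cong mat_vec_closed) (simp_all add: Pi_iff mat_memD(4) mult_entry mat_vec_def)
    finally show "(A \<otimes>\<^bsub>M\<^esub> B \<otimes>\<^bsub>M\<^esub> C) $$ (i, j) = (A \<otimes>\<^bsub>M\<^esub> (B \<otimes>\<^bsub>M\<^esub> C)) $$ (i, j)" .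
  qed (auto simp: mult_dim)
next
  fix A assume a: "A \<in> carrier M"
  have r: "(\<lambda>k. A $$ (i, k)) \<in> V" "(\<lambda>k. A $$ (k, i)) \<in> V" if "i < n" for i
    using a that by (auto simp: Pi_iff mat_memD(4))
  show "\<one>\<^bsub>M\<^esub> \<otimes>\<^bsub>M\<^esub> A = A"
  proof (rule M_eqI)
    fix i j assume ij: "i < n" "j < n"
    have "(\<one>\<^bsub>M\<^esub> \<otimes>\<^bsub>M\<^esub> A) $$ (i, j) = dot (axis i \<one>) (\<lambda>k. A $$ (k, j))"
      unfolding mult_entry[OF ij] using ij a by (intro dot_cong) (simp_all add: row_one Pi_iff mat_memD(4) axis_in)
    then show "(\<one>\<^bsub>M\<^esub> \<otimes>\<^bsub>M\<^esub> A) $$ (i, j) = A $$ (i, j)"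
      using ij r a by (simp add: dot_axis_left mat_memD)
  qed (use a in \<open>auto simp: mult_dim mat_memD\<close>)
  show "A \<otimes>\<^bsub>M\<^esub> \<one>\<^bsub>M\<^esub> = A"
  proof (rule M_eqI)
    fix i j assume ij: "i < n" "j < n"
    have "(A \<otimes>\<^bsub>M\<^esub> \<one>\<^bsub>M\<^esub>) $$ (i, j) = dot (\<lambda>k. A $$ (i, k)) (axis j \<one>)"
      unfolding mult_entry[OF ij] using ij a by (intro dot_cong) (simp_all add: col_one Pi_iff mat_memD(4) axis_in)
    then show "(A \<otimes>\<^bsub>M\<^esub> \<one>\<^bsub>M\<^esub>) $$ (i, j) = A $$ (i, j)"
      using ij r a by (simp add: dot_axis mat_memD)
  qed (use a in \<open>auto simp: mult_dim mat_memD\<close>)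
qed

lemma group_G: "group G"
  unfolding GL_def by (rule monoid.units_group[OF monoid_M])

lemma G_simps: "monoid.mult G = monoid.mult M" "\<one>\<^bsub>G\<^esub> = \<one>\<^bsub>M\<^esub>" "carrier G = Units M"
  by (simp_all add: GL_def units_of_mult units_of_one units_of_carrier)

lemma G_M: "A \<in> carrier G \<Longrightarrow> A \<in> carrier M"
  by (simp add: G_simps Units_def)

section \<open>Products, inverses and conjugates of dyads\<close>

lemma dyad_entry: "\<lbrakk>i < n; j < n\<rbrakk> \<Longrightarrow> dyad v w $$ (i, j) = (if i = j then \<one> else \<zero>) \<oplus> v i \<otimes> w j"
  by (simp add: dyad_def)

lemma dyad_dim: "dim_row (dyad v w) = n" "dim_col (dyad v w) = n" "dyad v w \<in> carrier_mat n n"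
  by (simp_all add: dyad_def)

lemma dyad_M: "\<lbrakk>v \<in> V; w \<in> V\<rbrakk> \<Longrightarrow> dyad v w \<in> carrier M"
  by (intro mat_memI) (auto simp: Pi_iff dyad_entry dyad_dim)

lemma dyad_cong: "\<lbrakk>\<And>i. i < n \<Longrightarrow> v i = v' i; \<And>i. i < n \<Longrightarrow> w i = w' i\<rbrakk> \<Longrightarrow> dyad v w = dyad v' w'"
  by (intro M_eqI) (auto simp: dyad_entry dyad_dim)

lemma dyad_zero: "w \<in> V \<Longrightarrow> dyad (\<lambda>_. \<zero>) w = \<one>\<^bsub>M\<^esub>"
  by (intro M_eqI) (auto simp: dyad_entry dyad_dim one_dim one_entry Pi_iff)

lemma dyad_zero_right: "w \<in> V \<Longrightarrow> dyad w (\<lambda>_. \<zero>) = \<one>\<^bsub>M\<^esub>"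
  by (intro M_eqI) (auto simp: dyad_entry dyad_dim one_dim one_entry Pi_iff)

lemma mult_dyad_entry:
  assumes "A \<in> carrier M" "v \<in> V" "w \<in> V" "i < n" "j < n"
  shows "(A \<otimes>\<^bsub>M\<^esub> dyad v w) $$ (i, j) = A $$ (i, j) \<oplus> mat_vec A v i \<otimes> w j"
proof -
  have w: "w j \<in> carrier R" using assms by auto
  have "(A \<otimes>\<^bsub>M\<^esub> dyad v w) $$ (i, j) = dot (\<lambda>k. A $$ (i, k)) (\<lambda>k. axis j \<one> k \<oplus> w j \<otimes> v k)"
    unfolding mult_entry[OF assms(4,5)] using assms w
    by (intro dot_cong) (simp_all add: dyad_entry axis_def m_comm Pi_iff mat_memD(4))
  also have "\<dots> = A $$ (i, j) \<oplus> w j \<otimes> mat_vec A v i"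
    unfolding mat_vec_def using assms w
    by (subst dot_add) (simp_all add: dot_smult dot_axis Pi_iff mat_memD(4) axis_in)
  also have "\<dots> = A $$ (i, j) \<oplus> mat_vec A v i \<otimes> w j"
    using w mat_vec_closed[OF assms(1,2)] assms(4) by (simp add: m_comm Pi_iff)
  finally show ?thesis .
qed

lemma mat_vec_dyad:
  assumes "v \<in> V" "w \<in> V" "u \<in> V" "i < n"
  shows "mat_vec (dyad v w) u i = u i \<oplus> v i \<otimes> dot w u"
proof -
  have v: "v i \<in> carrier R" using assms by auto
  have "mat_vec (dyad v w) u i = dot (\<lambda>k. axis i \<one> k \<oplus> v i \<otimes> w k) u"
    unfolding mat_vec_def using assms v by (intro dot_cong) (auto simp: Pi_iff dyad_entry axis_def)
  also have "\<dots> = u i \<oplus> v i \<otimes> dot w u"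
    using assms v by (subst dot_add_left) (auto simp: Pi_iff dot_smult_left dot_axis_left)
  finally show ?thesis .
qed

lemma vec_mat_dyad:
  assumes "v \<in> V" "w \<in> V" "u \<in> V" "i < n"
  shows "vec_mat u (dyad v w) i = u i \<oplus> dot u v \<otimes> w i"
proof -
  have v: "w i \<in> carrier R" using assms by auto
  have "vec_mat u (dyad v w) i = dot u (\<lambda>k. axis i \<one> k \<oplus> w i \<otimes> v k)"
    unfolding vec_mat_def using assms v by (intro dot_cong) (auto simp: Pi_iff dyad_entry axis_def m_comm)
  also have "\<dots> = u i \<oplus> dot u v \<otimes> w i"
    using assms v by (subst dot_add) (auto simp: Pi_iff dot_smult dot_axis m_comm)
  finally show ?thesis .
qed

text \<open>The cross term \<open>v (w v') w\<close> of the product vanishes because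
  \<open>w v' = 0\<close>, so columns add. Read backwards, the lemma factors a dyad by splitting its
  column; \<open>dyad_mult_right\<close> splits its row.\<close>

lemma dyad_mult_left:
  assumes "v \<in> V" "v' \<in> V" "w \<in> V" "dot w v' = \<zero>"
  shows "dyad v w \<otimes>\<^bsub>G\<^esub> dyad v' w = dyad (\<lambda>k. v k \<oplus> v' k) w"
  unfolding G_simps using assms
  by (intro M_eqI)
     (auto simp: mult_dim dyad_dim mult_dyad_entry dyad_M mat_vec_dyad dyad_entry l_distr Pi_iff a_assoc l_null r_null)

lemma dyad_mult_right:
  assumes "v \<in> V" "w' \<in> V" "w \<in> V" "dot w v = \<zero>"
  shows "dyad v w \<otimes>\<^bsub>G\<^esub> dyad v w' = dyad v (\<lambda>k. w k \<oplus> w' k)"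
  unfolding G_simps using assms
  by (intro M_eqI)
     (auto simp: mult_dim dyad_dim mult_dyad_entry dyad_M mat_vec_dyad dyad_entry r_distr Pi_iff a_assoc l_null r_null)

lemma dot_minus: "\<lbrakk>v \<in> V; w \<in> V\<rbrakk> \<Longrightarrow> dot w (\<lambda>k. \<ominus> v k) = \<ominus> dot w v"
proof -
  assume a: "v \<in> V" "w \<in> V"
  have "dot w (\<lambda>k. \<ominus> v k) = dot w (\<lambda>k. \<ominus> \<one> \<otimes> v k)"
    using a by (intro dot_cong) (auto simp: Pi_iff l_minus)
  then show ?thesis using a by (simp add: dot_smult l_minus)
qed

lemma dyad_inverse:
  assumes "v \<in> V" "w \<in> V" "dot w v = \<zero>"
  shows "dyad v w \<otimes>\<^bsub>G\<^esub> dyad (\<lambda>k. \<ominus> v k) w = \<one>\<^bsub>G\<^esub>" "dyad (\<lambda>k. \<ominus> v k) w \<otimes>\<^bsub>G\<^esub> dyad v w = \<one>\<^bsub>G\<^esub>"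
proof -
  have m: "(\<lambda>k. \<ominus> v k) \<in> V" using assms by auto
  have z: "dyad (\<lambda>k. v k \<oplus> \<ominus> v k) w = \<one>\<^bsub>G\<^esub>" "dyad (\<lambda>k. \<ominus> v k \<oplus> v k) w = \<one>\<^bsub>G\<^esub>"
    unfolding G_simps dyad_zero[OF assms(2), symmetric] using assms
    by (auto intro!: dyad_cong simp: Pi_iff r_neg l_neg)
  show "dyad v w \<otimes>\<^bsub>G\<^esub> dyad (\<lambda>k. \<ominus> v k) w = \<one>\<^bsub>G\<^esub>"
    using assms m by (simp add: dyad_mult_left dot_minus z)
  show "dyad (\<lambda>k. \<ominus> v k) w \<otimes>\<^bsub>G\<^esub> dyad v w = \<one>\<^bsub>G\<^esub>"
    using assms m by (simp add: dyad_mult_left dot_minus z)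
qed

lemma dyad_G:
  assumes "v \<in> V" "w \<in> V" "dot w v = \<zero>"
  shows "dyad v w \<in> carrier G"
  using dyad_inverse[OF assms] dyad_M[OF assms(1,2)] dyad_M[of "\<lambda>k. \<ominus> v k" w] assms
  by (auto simp: G_simps Units_def)

lemma dyad_inv:
  assumes "v \<in> V" "w \<in> V" "dot w v = \<zero>"
  shows "inv\<^bsub>G\<^esub> (dyad v w) = dyad (\<lambda>k. \<ominus> v k) w"
proof -
  have "dot w (\<lambda>k. \<ominus> v k) = \<zero>" using assms by (simp add: dot_minus)
  then show ?thesis
    using group.inv_equality[OF group_G dyad_inverse(2)[OF assms]] dyad_G assms by (simp add: Pi_iff)
qed

text \<open>Distribute \<open>(A + (A v) w)\<close> over the inverse of \<open>A\<close>: the first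
  summand becomes the identity matrix.\<close>

lemma conj_dyad:
  assumes A: "A \<in> carrier G" and v: "v \<in> V" "w \<in> V" "dot w v = \<zero>"
  shows "A \<otimes>\<^bsub>G\<^esub> dyad v w \<otimes>\<^bsub>G\<^esub> inv\<^bsub>G\<^esub> A = dyad (mat_vec A v) (vec_mat w (inv\<^bsub>G\<^esub> A))"
proof -
  interpret G: group G by (rule group_G)
  let ?B = "inv\<^bsub>G\<^esub> A"
  have B: "?B \<in> carrier M" "A \<in> carrier M" using A G_M by auto
  have c: "A \<otimes>\<^bsub>M\<^esub> dyad v w \<in> carrier M"
    using monoid.m_closed[OF monoid_M B(2) dyad_M] v by blast
  have AB: "A \<otimes>\<^bsub>M\<^esub> ?B = \<one>\<^bsub>M\<^esub>" using G.r_inv[OF A] by (simp add: G_simps)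
  show ?thesis
  proof (rule M_eqI)
    fix i j assume ij: "i < n" "j < n"
    have mv: "mat_vec A v i \<in> carrier R" using mat_vec_closed[OF B(2) v(1)] ij by auto
    have "(A \<otimes>\<^bsub>M\<^esub> dyad v w \<otimes>\<^bsub>M\<^esub> ?B) $$ (i, j) = dot (\<lambda>k. A $$ (i, k) \<oplus> mat_vec A v i \<otimes> w k) (\<lambda>k. ?B $$ (k, j))"
      unfolding mult_entry[OF ij] using ij A v B mv
      by (intro dot_cong) (simp_all add: mult_dyad_entry Pi_iff mat_memD(4))
    also have "\<dots> = dot (\<lambda>k. A $$ (i, k)) (\<lambda>k. ?B $$ (k, j)) \<oplus> mat_vec A v i \<otimes> vec_mat w ?B j"
      unfolding vec_mat_def using ij B v mv row_closed[OF B(2) ij(1)] col_closed[OF B(1) ij(2)]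
      by (subst dot_add_left) (auto simp: dot_smult_left)
    also have "\<dots> = dyad (mat_vec A v) (vec_mat w ?B) $$ (i, j)"
      using ij by (simp add: dyad_entry AB mult_entry[symmetric] one_entry)
    finally show "(A \<otimes>\<^bsub>G\<^esub> dyad v w \<otimes>\<^bsub>G\<^esub> inv\<^bsub>G\<^esub> A) $$ (i, j) = dyad (mat_vec A v) (vec_mat w ?B) $$ (i, j)"
      by (simp add: G_simps)
  qed (auto simp: G_simps mult_dim dyad_dim)
qed

text \<open>Here \<open>(e + p q) v = v + p (q v)\<close> and
  \<open>w (e - p q) = w - (w p) q\<close>. The explicit commutator computations below rest on this
  formula: a vanishing pairing means that the corresponding side is left unchanged.\<close>

lemma conj_dyad_dyad:
  assumes p: "p \<in> V" "q \<in> V" "dot q p = \<zero>" and v: "v \<in> V" "w \<in> V" "dot w v = \<zero>"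
  shows "dyad p q \<otimes>\<^bsub>G\<^esub> dyad v w \<otimes>\<^bsub>G\<^esub> inv\<^bsub>G\<^esub> (dyad p q)
    = dyad (\<lambda>k. v k \<oplus> p k \<otimes> dot q v) (\<lambda>k. w k \<ominus> dot w p \<otimes> q k)"
proof -
  have m: "(\<lambda>k. \<ominus> p k) \<in> V" using p by auto
  show ?thesis
    unfolding conj_dyad[OF dyad_G[OF p] v] unfolding dyad_inv[OF p] using p v m
    by (intro dyad_cong) (auto simp: mat_vec_dyad vec_mat_dyad dot_minus l_minus minus_eq Pi_iff)
qed

section \<open>Transvections and the elementary group\<close>

lemma transvection_dyad: "\<lbrakk>i < n; j < n; x \<in> carrier R\<rbrakk> \<Longrightarrow> transvection n R i j x = dyad (axis i x) (axis j \<one>)"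
  by (intro M_eqI) (auto simp: transvection_def dyad_def axis_def)

abbreviation "T \<equiv> transvection n R"
abbreviation "E \<equiv> elementary_group n R (carrier R)"

lemma transvection_G: "\<lbrakk>i < n; j < n; i \<noteq> j; x \<in> carrier R\<rbrakk> \<Longrightarrow> T i j x \<in> carrier G"
  unfolding transvection_dyad by (intro dyad_G) (auto simp: dot_axis axis_apply)

lemma transvection_inv:
  "\<lbrakk>i < n; j < n; i \<noteq> j; x \<in> carrier R\<rbrakk> \<Longrightarrow> inv\<^bsub>G\<^esub> (T i j x) = T i j (\<ominus> x)"
  unfolding transvection_dyad by (subst dyad_inv) (auto simp: dot_axis axis_apply transvection_dyad intro!: dyad_cong)

lemma elementary_gens: "{T i j x |i j x. i < n \<and> j < n \<and> i \<noteq> j \<and> x \<in> carrier R} \<subseteq> carrier G"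
  by (auto intro: transvection_G)

lemma subgroup_E: "subgroup E G"
  unfolding elementary_group_def by (rule group.generate_is_subgroup[OF group_G elementary_gens])

lemma transvection_E: "\<lbrakk>i < n; j < n; i \<noteq> j; x \<in> carrier R\<rbrakk> \<Longrightarrow> T i j x \<in> E"
  unfolding elementary_group_def by (rule generate.incl) blast

lemma dyad_scale:
  "\<lbrakk>y \<in> carrier R; v \<in> V; w \<in> V\<rbrakk> \<Longrightarrow> dyad v (\<lambda>k. y \<otimes> w k) = dyad (\<lambda>k. y \<otimes> v k) w"
  by (intro M_eqI) (auto simp: dyad_dim dyad_entry Pi_iff m_lcomm m_assoc)

lemma dyad_axis:
  assumes "v \<in> V" "y \<in> carrier R"
  shows "dyad v (axis l y) = dyad (\<lambda>k. y \<otimes> v k) (axis l \<one>)"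
proof -
  have "dyad v (axis l y) = dyad v (\<lambda>k. y \<otimes> axis l \<one> k)"
    using assms by (intro dyad_cong) (auto simp: axis_apply)
  then show ?thesis using assms by (simp add: dyad_scale)
qed

text \<open>Columns add for the fixed row \<open>axis l \<one>\<close>, so the matrix is the product
  of the transvections \<open>T k l (v k)\<close>, adjoined in the order of their row index.\<close>

lemma dyad_column_mem:
  assumes K: "subgroup K G" and l: "l < n" and v: "v \<in> V" "v l = \<zero>"
    and T: "\<And>k. \<lbrakk>k < n; k \<noteq> l\<rbrakk> \<Longrightarrow> T k l (v k) \<in> K"
  shows "dyad v (axis l \<one>) \<in> K"
proof -
  \<comment> \<open>Truncation of \<open>v\<close> to its first \<open>m\<close> entries. Passing
    the index \<open>l\<close> changes nothing, since \<open>v l = \<zero>\<close>.\<close>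
  let ?f = "\<lambda>m k. if k < m then v k else \<zero>"
  have "dyad (?f m) (axis l \<one>) \<in> K" if "m \<le> n" for m
    using that
  proof (induction m)
    case 0
    then show ?case
      using subgroup.one_closed[OF K] by (simp add: dyad_zero G_simps)
  next
    case (Suc m)
    then have IH: "dyad (?f m) (axis l \<one>) \<in> K" and m: "m < n" by auto
    show ?case
    proof (cases "m = l")
      case True
      have "dyad (?f (Suc m)) (axis l \<one>) = dyad (?f m) (axis l \<one>)"
        using True v by (intro dyad_cong) (auto simp: less_Suc_eq)
      then show ?thesis using IH by simp
    next
      case False
      have "dyad (?f (Suc m)) (axis l \<one>) = dyad (\<lambda>k. ?f m k \<oplus> axis m (v m) k) (axis l \<one>)"
        using v by (intro dyad_cong) (auto simp: axis_apply less_Suc_eq Pi_iff)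
      also have "\<dots> = dyad (?f m) (axis l \<one>) \<otimes>\<^bsub>G\<^esub> T m l (v m)"
        using v m l False
        by (simp add: transvection_dyad Pi_iff) (subst dyad_mult_left, auto simp: Pi_iff dot_axis_left axis_apply)
      finally show ?thesis
        using subgroup.m_closed[OF K IH T[OF m False]] by simp
    qed
  qed
  from this[of n] have "dyad (?f n) (axis l \<one>) \<in> K" by simp
  moreover have "dyad (?f n) (axis l \<one>) = dyad v (axis l \<one>)"
    by (intro dyad_cong) auto
  ultimately show ?thesis by simp
qed

lemma dyad_axis_axis:
  assumes "k < n" "i < n" "y \<in> carrier R" "a \<in> carrier R"
  shows "dyad (axis k y) (axis i a) = T k i (y \<otimes> a)"
  unfolding transvection_dyad[OF assms(1,2) m_closed[OF assms(3,4)]] dyad_axis[OF axis_closed[OF assms(3)] assms(4)]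
  using assms by (intro dyad_cong) (auto simp: axis_apply m_comm)

lemma dyad_axis_pair:
  assumes "k < n" "i < n" "j < n" "k \<noteq> i" "y \<in> carrier R" "a \<in> carrier R" "b \<in> carrier R"
  shows "dyad (axis k y) (\<lambda>m. axis i a m \<oplus> axis j b m) = T k i (y \<otimes> a) \<otimes>\<^bsub>G\<^esub> T k j (y \<otimes> b)"
proof -
  have "dot (axis i a) (axis k y) = \<zero>"
    using assms by (simp add: dot_axis axis_apply)
  then show ?thesis
    using assms by (subst dyad_mult_right[symmetric]) (auto simp: dyad_axis_axis)
qed

text \<open>The right-hand side is the commutator of \<open>e + p e_r\<close> and \<open>e + y e_r q\<close>.\<close>

lemma dyad_commutator:
  assumes p: "p \<in> V" "q \<in> V" "dot q p = \<zero>" and r: "r < n" "p r = \<zero>" "q r = \<zero>" and y: "y \<in> carrier R"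
  defines "A \<equiv> dyad p (axis r \<one>)" and "B \<equiv> dyad (axis r y) q"
  shows "dyad (\<lambda>m. y \<otimes> p m) q = inv\<^bsub>G\<^esub> B \<otimes>\<^bsub>G\<^esub> (A \<otimes>\<^bsub>G\<^esub> B \<otimes>\<^bsub>G\<^esub> inv\<^bsub>G\<^esub> A)"
proof -
  interpret G: group G by (rule group_G)
  have yp: "(\<lambda>m. y \<otimes> p m) \<in> V" using p y by (auto simp: Pi_iff)
  have d: "dot q (\<lambda>m. y \<otimes> p m) = \<zero>" "dot q (axis r y) = \<zero>" "dot (axis r \<one>) p = \<zero>"
    using assms by (simp_all add: dot_smult dot_axis dot_axis_left)
  have BG: "B \<in> carrier G" "dyad (\<lambda>m. y \<otimes> p m) q \<in> carrier G"
    unfolding B_def using p y yp d by (auto intro!: dyad_G)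
  have "A \<otimes>\<^bsub>G\<^esub> B \<otimes>\<^bsub>G\<^esub> inv\<^bsub>G\<^esub> A = dyad (\<lambda>m. axis r y m \<oplus> y \<otimes> p m) q"
    unfolding A_def B_def using p y r d
    by (subst conj_dyad_dyad) (auto simp: dot_axis dot_axis_left axis_apply Pi_iff m_comm minus_eq intro!: dyad_cong)
  also have "\<dots> = B \<otimes>\<^bsub>G\<^esub> dyad (\<lambda>m. y \<otimes> p m) q"
    unfolding B_def using p y yp d by (subst dyad_mult_left) auto
  finally show ?thesis
    using BG by (simp add: G.m_assoc[symmetric])
qed

text \<open>Each row \<open>f s\<close> kills \<open>v\<close>, so the dyad of the summed row is the
  product of the dyads of the summands. This turns Suslin's sum of rows into a product of
  matrices.\<close>

lemma dyad_sum_mem: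
  assumes K: "subgroup K G" and S: "finite S" and v: "v \<in> V"
    and f: "\<And>s. s \<in> S \<Longrightarrow> f s \<in> V" "\<And>s. s \<in> S \<Longrightarrow> dot (f s) v = \<zero>" "\<And>s. s \<in> S \<Longrightarrow> dyad v (f s) \<in> K"
  shows "dyad v (\<lambda>m. \<Oplus>s\<in>S. f s m) \<in> K"
  using S f
proof (induction S rule: finite_induct)
  case empty
  then show ?case
    using subgroup.one_closed[OF K] v by (simp add: dyad_zero_right G_simps)
next
  case (insert a S)
  have c: "(\<lambda>m. \<Oplus>s\<in>S. f s m) \<in> V"
    using insert by (auto simp: Pi_iff intro!: finsum_closed)
  have "dyad v (\<lambda>m. \<Oplus>s\<in>insert a S. f s m) = dyad v (\<lambda>m. f a m \<oplus> (\<Oplus>s\<in>S. f s m))"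
    using insert by (intro dyad_cong refl finsum_insert) (auto simp: Pi_iff)
  also have "\<dots> = dyad v (f a) \<otimes>\<^bsub>G\<^esub> dyad v (\<lambda>m. \<Oplus>s\<in>S. f s m)"
    using insert v c by (intro dyad_mult_right[symmetric]) auto
  also have "\<dots> \<in> K"
    using insert by (intro subgroup.m_closed[OF K]) auto
  finally show ?case .
qed

text \<open>Row \<open>k\<close> of the inverse times \<open>A\<close> is a unit row. With
  \<open>v k = \<zero>\<close> this shows that a conjugated dyad again has orthogonal sides.\<close>

lemma inverse_row_dot:
  assumes A: "A \<in> carrier G" and v: "v \<in> V" and k: "k < n"
  shows "dot (\<lambda>m. (inv\<^bsub>G\<^esub> A) $$ (k, m)) (mat_vec A v) = v k"
proof -
  interpret G: group G by (rule group_G)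
  let ?B = "inv\<^bsub>G\<^esub> A"
  have AB: "A \<in> carrier M" "?B \<in> carrier M" "?B \<otimes>\<^bsub>M\<^esub> A = \<one>\<^bsub>M\<^esub>"
    using A G_M[OF A] G_M[OF G.inv_closed[OF A]] G.l_inv[OF A] by (auto simp: G_simps)
  have "dot (\<lambda>m. ?B $$ (k, m)) (mat_vec A v) = dot (vec_mat (\<lambda>m. ?B $$ (k, m)) A) v"
    using AB v k by (intro dot_mat[symmetric] row_closed)
  also have "\<dots> = dot (axis k \<one>) v"
    using AB v k by (intro dot_cong) (auto simp: vec_mat_def mult_entry[symmetric] one_entry axis_apply)
  finally show ?thesis using v k by (simp add: dot_axis_left Pi_iff)
qed

lemma conj_dyad_axis:
  assumes A: "A \<in> carrier G" and v: "v \<in> V" "v k = \<zero>" and k: "k < n"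
  shows "A \<otimes>\<^bsub>G\<^esub> dyad v (axis k \<one>) \<otimes>\<^bsub>G\<^esub> inv\<^bsub>G\<^esub> A = dyad (mat_vec A v) (\<lambda>m. (inv\<^bsub>G\<^esub> A) $$ (k, m))"
proof -
  interpret G: group G by (rule group_G)
  have B: "inv\<^bsub>G\<^esub> A \<in> carrier M" using G_M[OF G.inv_closed[OF A]] .
  show ?thesis
    using assms B
    by (subst conj_dyad)
       (auto simp: dot_axis_left Pi_iff vec_mat_def mat_memD(4) intro!: dyad_cong)
qed

end

section \<open>Subgroups normalized by the elementary group\<close>

text \<open>The locale is used for both implications: with \<open>N = H\<close> to find the ideal,
  and with \<open>N\<close> the relative elementary group of a given ideal to prove the
  converse.\<close>

locale E_normalized = cring_matrix +
  fixes N
  assumes n3: "n \<ge> 3" and subgroup_N: "subgroup N G"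
    and E_conj: "\<And>g h. \<lbrakk>g \<in> E; h \<in> N\<rbrakk> \<Longrightarrow> g \<otimes>\<^bsub>G\<^esub> h \<otimes>\<^bsub>G\<^esub> inv\<^bsub>G\<^esub> g \<in> N"
begin

sublocale G: group G by (rule group_G)
sublocale N: subgroup N G by (rule subgroup_N)
sublocale E: subgroup E G by (rule subgroup_E)

text \<open>Here \<open>n \<ge> 3\<close> provides the room for commutators. The two given indices
  may coincide.\<close>

lemma third_index: obtains r where "r < n" "r \<noteq> i" "r \<noteq> j"
proof -
  have "card {i, j} < card {..<n}"
    using n3 by (simp add: card_insert_if)
  then have "\<not> {..<n} \<subseteq> {i, j}"
    using card_mono[of "{i, j}" "{..<n}"] by auto
  then show ?thesis using that by auto
qed

lemma commutator_mem:
  assumes "g \<in> E" "h \<in> N"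
  shows "inv\<^bsub>G\<^esub> h \<otimes>\<^bsub>G\<^esub> (g \<otimes>\<^bsub>G\<^esub> h \<otimes>\<^bsub>G\<^esub> inv\<^bsub>G\<^esub> g) \<in> N"
    and "h \<otimes>\<^bsub>G\<^esub> g \<otimes>\<^bsub>G\<^esub> inv\<^bsub>G\<^esub> h \<otimes>\<^bsub>G\<^esub> inv\<^bsub>G\<^esub> g \<in> N"
proof -
  show "inv\<^bsub>G\<^esub> h \<otimes>\<^bsub>G\<^esub> (g \<otimes>\<^bsub>G\<^esub> h \<otimes>\<^bsub>G\<^esub> inv\<^bsub>G\<^esub> g) \<in> N"
    using assms E_conj by auto
  have "h \<otimes>\<^bsub>G\<^esub> (g \<otimes>\<^bsub>G\<^esub> inv\<^bsub>G\<^esub> h \<otimes>\<^bsub>G\<^esub> inv\<^bsub>G\<^esub> g) \<in> N"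
    using assms E_conj by auto
  then show "h \<otimes>\<^bsub>G\<^esub> g \<otimes>\<^bsub>G\<^esub> inv\<^bsub>G\<^esub> h \<otimes>\<^bsub>G\<^esub> inv\<^bsub>G\<^esub> g \<in> N"
    using assms by (simp add: G.m_assoc)
qed

text \<open>The Steinberg relation, as the case \<open>p = axis i x\<close>,
  \<open>q = axis j \<one>\<close> of \<open>dyad_commutator\<close>. The factors are ordered as in
  \<open>commutator_mem\<close>, where the inner matrix belongs to \<open>N\<close>.\<close>

lemma transvection_commutator:
  assumes "i < n" "j < n" "r < n" "i \<noteq> j" "r \<noteq> i" "r \<noteq> j" "x \<in> carrier R" "y \<in> carrier R"
  shows "T i j (x \<otimes> y) = inv\<^bsub>G\<^esub> (T r j y) \<otimes>\<^bsub>G\<^esub> (T i r x \<otimes>\<^bsub>G\<^esub> T r j y \<otimes>\<^bsub>G\<^esub> inv\<^bsub>G\<^esub> (T i r x))"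
proof -
  have "T i j (x \<otimes> y) = dyad (\<lambda>m. y \<otimes> axis i x m) (axis j \<one>)"
    using assms unfolding transvection_dyad[OF assms(1,2) m_closed[OF assms(7,8)]]
    by (intro dyad_cong) (auto simp: axis_apply m_comm)
  then show ?thesis
    using assms dyad_commutator[of "axis i x" "axis j \<one>" r y]
    by (simp add: transvection_dyad dot_axis) (simp add: axis_apply)
qed

section \<open>The level ideal of \<open>N\<close>\<close>

definition level :: "'a set" where
  "level = {x \<in> carrier R. \<forall>i<n. \<forall>j<n. i \<noteq> j \<longrightarrow> T i j x \<in> N}"

text \<open>In the Steinberg relation the member of \<open>N\<close> is now the conjugating factor;
  regrouping shows an elementary conjugate of it times its inverse.\<close>

lemma transvection_row_mult:
  assumes "i < n" "j < n" "k < n" "i \<noteq> j" "k \<noteq> i" "k \<noteq> j" "s \<in> carrier R" "x \<in> carrier R" "T i j s \<in> N"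
  shows "T i k (s \<otimes> x) \<in> N"
proof -
  have "inv\<^bsub>G\<^esub> (T j k x) \<otimes>\<^bsub>G\<^esub> (T i j s \<otimes>\<^bsub>G\<^esub> T j k x \<otimes>\<^bsub>G\<^esub> inv\<^bsub>G\<^esub> (T i j s))
    = inv\<^bsub>G\<^esub> (T j k x) \<otimes>\<^bsub>G\<^esub> T i j s \<otimes>\<^bsub>G\<^esub> inv\<^bsub>G\<^esub> (inv\<^bsub>G\<^esub> (T j k x)) \<otimes>\<^bsub>G\<^esub> inv\<^bsub>G\<^esub> (T i j s)"
    using assms by (simp add: G.m_assoc transvection_G)
  also have "\<dots> \<in> N"
    using assms by (intro N.m_closed E_conj E.m_inv_closed N.m_inv_closed transvection_E) auto
  finally show ?thesis
    using assms transvection_commutator[of i k j s x] by simp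
qed

lemma transvection_col_mult:
  assumes "i < n" "j < n" "k < n" "i \<noteq> j" "k \<noteq> i" "k \<noteq> j" "s \<in> carrier R" "x \<in> carrier R" "T i j s \<in> N"
  shows "T k j (s \<otimes> x) \<in> N"
  using assms transvection_commutator[of k j i x s] commutator_mem(1)[of "T k i x" "T i j s"]
  by (simp add: transvection_E m_comm)

text \<open>One index is changed at a time, along \<open>(i, j)\<close>, \<open>(i, r)\<close>,
  \<open>(p, r)\<close>, \<open>(p, q)\<close> with \<open>r\<close> different from \<open>i\<close>
  and \<open>p\<close>. The factor \<open>x\<close> enters in the last move.\<close>

lemma transvection_spread:
  assumes "i < n" "j < n" "i \<noteq> j" "s \<in> carrier R" "T i j s \<in> N"
    and pq: "p < n" "q < n" "p \<noteq> q" and x: "x \<in> carrier R"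
  shows "T p q (s \<otimes> x) \<in> N"
proof -
  have row: "T i q (s \<otimes> x) \<in> N" if "T i j s \<in> N" "i < n" "j < n" "q < n" "i \<noteq> j" "q \<noteq> i" "x \<in> carrier R" for i j q x
  proof (cases "q = j")
    \<comment> \<open>A commutator always moves to a new column, so staying in column
      \<open>j\<close> takes a detour through a third column \<open>r\<close>.\<close>
    case True
    obtain r where r: "r < n" "r \<noteq> i" "r \<noteq> j" by (rule third_index)
    have "T i r (s \<otimes> \<one>) \<in> N"
      using that r assms(4) by (intro transvection_row_mult[of i j r s \<one>]) auto
    then have "T i r s \<in> N" using assms(4) by simp
    then show ?thesis
      using that r assms(4) True by (intro transvection_row_mult[of i r q s x]) auto
  next
    case False
    then show ?thesis using that assms(4) by (intro transvection_row_mult[of i j q s x]) auto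
  qed
  have one: "T i q s \<in> N" if "T i j s \<in> N" "i < n" "j < n" "q < n" "i \<noteq> j" "q \<noteq> i" for i j q
    using row[OF that one_closed] assms(4) by simp
  obtain r where r: "r < n" "r \<noteq> i" "r \<noteq> p" by (rule third_index)
  have ir: "T i r s \<in> N" using one[OF assms(5,1,2) r(1)] assms r by auto
  have "T p r s \<in> N"
  proof (cases "p = i")
    case True
    then show ?thesis using ir by simp
  next
    case False
    have "T p r (s \<otimes> \<one>) \<in> N"
      using assms ir r False by (intro transvection_col_mult[of i r p s \<one>]) auto
    then show ?thesis using assms(4) by simp
  qed
  then show ?thesis using row[of p r q x] pq r x by auto
qed

text \<open>Spreading with factor \<open>\<one>\<close>: a single off-diagonal position already
  yields all those demanded by \<open>level\<close>.\<close>

lemma levelI: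
  assumes "i < n" "j < n" "i \<noteq> j" "s \<in> carrier R" "T i j s \<in> N"
  shows "s \<in> level"
  using transvection_spread[OF assms _ _ _ one_closed] assms by (auto simp: level_def)

lemma transvection_add:
  assumes "i < n" "j < n" "i \<noteq> j" "x \<in> carrier R" "y \<in> carrier R"
  shows "T i j (x \<oplus> y) = T i j x \<otimes>\<^bsub>G\<^esub> T i j y"
  using assms by (simp add: transvection_dyad dyad_mult_left dot_axis)
    (subst dyad_mult_left, auto simp: dot_axis axis_apply intro!: dyad_cong)

lemma ideal_level: "ideal level R"
proof (rule idealI[OF ring_axioms])
  have n: "0 < n" "1 < n" using n3 by auto
  show "subgroup level (add_monoid R)"
  proof
    show "level \<subseteq> carrier (add_monoid R)" by (auto simp: level_def)
    show "\<one>\<^bsub>add_monoid R\<^esub> \<in> level"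
    proof -
      have "T i j \<zero> = \<one>\<^bsub>G\<^esub>" if "i < n" "j < n" for i j
        unfolding transvection_dyad[OF that zero_closed] G_simps
        by (subst dyad_zero[of "axis j \<one>", symmetric]) (auto simp: axis_apply intro!: dyad_cong)
      then show ?thesis by (simp add: level_def)
    qed
  next
    fix x y assume "x \<in> level" "y \<in> level"
    then show "x \<otimes>\<^bsub>add_monoid R\<^esub> y \<in> level"
      by (simp add: level_def transvection_add)
  next
    fix x assume "x \<in> level"
    then have "\<ominus> x \<in> level"
      by (auto simp: level_def transvection_inv[symmetric])
    then show "inv\<^bsub>add_monoid R\<^esub> x \<in> level" by (simp add: a_inv_def)
  qed
  fix a x assume a: "a \<in> level" "x \<in> carrier R"
  then have "a \<in> carrier R" "T 0 1 a \<in> N" using n by (auto simp: level_def)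
  then show "a \<otimes> x \<in> level"
    using transvection_spread[of 0 1 a _ _ x] a n by (auto simp: level_def)
  then show "x \<otimes> a \<in> level"
    using a \<open>a \<in> carrier R\<close> by (simp add: m_comm)
qed

text \<open>With \<open>z = t\<^sup>-\<^sup>1 c\<close>, which is a commutator of \<open>s\<close>
  and lies in \<open>N\<close>, the matrix is the commutator of \<open>z\<close> and
  \<open>y\<close>, conjugated by \<open>t\<close>. In this form only conjugates of \<open>y\<close>
  by the dyads \<open>c\<close> and \<open>t\<close> have to be computed.\<close>

lemma double_commutator_mem:
  assumes s: "s \<in> N" and "t \<in> E" "y \<in> E"
  defines "c \<equiv> s \<otimes>\<^bsub>G\<^esub> t \<otimes>\<^bsub>G\<^esub> inv\<^bsub>G\<^esub> s"
  shows "(c \<otimes>\<^bsub>G\<^esub> y \<otimes>\<^bsub>G\<^esub> inv\<^bsub>G\<^esub> c) \<otimes>\<^bsub>G\<^esub> inv\<^bsub>G\<^esub> (t \<otimes>\<^bsub>G\<^esub> y \<otimes>\<^bsub>G\<^esub> inv\<^bsub>G\<^esub> t) \<in> N"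
proof -
  have G: "s \<in> carrier G" "t \<in> carrier G" "y \<in> carrier G" "c \<in> carrier G"
    using assms by auto
  define z where "z = inv\<^bsub>G\<^esub> t \<otimes>\<^bsub>G\<^esub> c"
  have "inv\<^bsub>G\<^esub> t \<otimes>\<^bsub>G\<^esub> s \<otimes>\<^bsub>G\<^esub> inv\<^bsub>G\<^esub> (inv\<^bsub>G\<^esub> t) \<otimes>\<^bsub>G\<^esub> inv\<^bsub>G\<^esub> s \<in> N"
    using assms by (intro N.m_closed E_conj) auto
  then have z: "z \<in> N" using G by (simp add: z_def c_def G.m_assoc)
  have "t \<otimes>\<^bsub>G\<^esub> (z \<otimes>\<^bsub>G\<^esub> y \<otimes>\<^bsub>G\<^esub> inv\<^bsub>G\<^esub> z \<otimes>\<^bsub>G\<^esub> inv\<^bsub>G\<^esub> y) \<otimes>\<^bsub>G\<^esub> inv\<^bsub>G\<^esub> t \<in> N"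
    using E_conj[OF assms(2) commutator_mem(2)[OF assms(3) z]] .
  moreover have "t \<otimes>\<^bsub>G\<^esub> (z \<otimes>\<^bsub>G\<^esub> u) = c \<otimes>\<^bsub>G\<^esub> u" if "u \<in> carrier G" for u
    using G that by (simp add: z_def G.m_assoc[symmetric])
  moreover have "inv\<^bsub>G\<^esub> z = inv\<^bsub>G\<^esub> c \<otimes>\<^bsub>G\<^esub> t"
    using G by (simp add: z_def G.inv_mult_group)
  ultimately show ?thesis
    using G z by (simp add: G.m_assoc G.inv_mult_group)
qed

lemma offdiagonal_in_level:
  assumes s: "s \<in> N" and ij: "i < n" "j < n" "i \<noteq> j"
  shows "s $$ (i, j) \<in> level"
proof -
  obtain k where k: "k < n" "k \<noteq> i" "k \<noteq> j" by (rule third_index)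
  have sG: "s \<in> carrier G" using s by simp
  have sM: "s \<in> carrier M" "inv\<^bsub>G\<^esub> s \<in> carrier M" using G_M[OF sG] G_M[OF G.inv_closed[OF sG]] by auto
  define c where "c = s $$ (i, j)"
  define d where "d = s $$ (i, i)"
  have cd: "c \<in> carrier R" "d \<in> carrier R"
    using sM ij by (auto simp: c_def d_def mat_memD(4))
  define a where "a = (\<lambda>m. axis i (\<ominus> c) m \<oplus> axis j d m)"
  have aV: "a \<in> V" using cd by (auto simp: a_def)
  have ak: "a k = \<zero>" "a i = \<ominus> c" using ij k cd by (auto simp: a_def axis_apply)
  define t where "t = dyad a (axis k \<one>)"
  have tE: "t \<in> E"
    unfolding t_def using aV ak k by (intro dyad_column_mem subgroup_E transvection_E) (auto simp: Pi_iff)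
  define v where "v = mat_vec s a"
  define w where "w = (\<lambda>m. (inv\<^bsub>G\<^esub> s) $$ (k, m))"
  have vV: "v \<in> V" and wV: "w \<in> V" unfolding v_def w_def using mat_vec_closed[OF sM(1) aV] row_closed[OF sM(2) k(1)] by simp_all
  have wv: "dot w v = \<zero>"
    unfolding w_def v_def using inverse_row_dot[OF sG aV k(1)] ak by simp
  have rowV: "(\<lambda>m. s $$ (i, m)) \<in> V" using row_closed[OF sM(1) ij(1)] .
  \<comment> \<open>Commutativity of the ring enters here: the two products of the entries
    \<open>c\<close> and \<open>d\<close> cancel.\<close>
  have vi: "v i = \<zero>"
  proof -
    have "v i = s $$ (i, i) \<otimes> \<ominus> c \<oplus> s $$ (i, j) \<otimes> d"
      unfolding v_def mat_vec_def a_def using rowV cd ij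
      by (subst dot_add) (auto simp: dot_axis)
    also have "\<dots> = \<ominus> (d \<otimes> c) \<oplus> c \<otimes> d"
      using cd by (simp add: r_minus c_def[symmetric] d_def[symmetric])
    also have "\<dots> = \<zero>"
      using cd by (simp add: m_comm l_neg)
    finally show ?thesis .
  qed
  define y where "y = T j i \<one>"
  have y: "y \<in> E" "y = dyad (axis j \<one>) (axis i \<one>)"
    unfolding y_def using ij by (simp add: transvection_E, simp add: transvection_dyad)
  define x where "x = s \<otimes>\<^bsub>G\<^esub> t \<otimes>\<^bsub>G\<^esub> inv\<^bsub>G\<^esub> s"
  have x: "x = dyad v w"
    unfolding x_def t_def v_def w_def using sG aV ak k by (intro conj_dyad_axis) auto
  \<comment> \<open>Conjugating \<open>y\<close> by \<open>x\<close> keeps the row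
    \<open>axis i \<one>\<close> because \<open>v i = \<zero>\<close>; its column becomes
    \<open>m\<close>.\<close>
  define m where "m = (\<lambda>l. axis j \<one> l \<oplus> v l \<otimes> w j)"
  have mV: "m \<in> V" and mi: "m i = \<zero>"
    using vV wV ij vi by (auto simp: m_def Pi_iff axis_apply)
  define P where "P = x \<otimes>\<^bsub>G\<^esub> y \<otimes>\<^bsub>G\<^esub> inv\<^bsub>G\<^esub> x"
  have P: "P = dyad m (axis i \<one>)"
    unfolding P_def x y(2) m_def using ij vV wV wv vi
    by (subst conj_dyad_dyad) (auto simp: dot_axis dot_axis_left Pi_iff minus_eq axis_apply intro!: dyad_cong)
  \<comment> \<open>Conjugating \<open>y\<close> by \<open>t\<close> keeps the column
    \<open>axis j \<one>\<close>. The row gains \<open>- a i\<close> at position \<open>k\<close>,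
    and this is how the entry \<open>c\<close> comes in.\<close>
  define b where "b = (\<lambda>l. axis i \<one> l \<oplus> axis k c l)"
  have bV: "b \<in> V" using cd by (auto simp: b_def)
  have bj: "b j = \<zero>" "b k = c" using ij k cd by (auto simp: b_def axis_apply)
  define Q where "Q = inv\<^bsub>G\<^esub> (t \<otimes>\<^bsub>G\<^esub> y \<otimes>\<^bsub>G\<^esub> inv\<^bsub>G\<^esub> t)"
  have "t \<otimes>\<^bsub>G\<^esub> y \<otimes>\<^bsub>G\<^esub> inv\<^bsub>G\<^esub> t = dyad (axis j \<one>) b"
    unfolding t_def y(2) b_def using ij k aV ak cd
    by (subst conj_dyad_dyad) (auto simp: dot_axis dot_axis_left Pi_iff minus_eq axis_apply intro!: dyad_cong)
  then have "Q = dyad (\<lambda>l. \<ominus> axis j \<one> l) b"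
    unfolding Q_def using bV bj ij by (simp add: dyad_inv dot_axis)
  then have Q: "Q = dyad (axis j (\<ominus> \<one>)) b"
    by (auto simp: axis_apply intro!: dyad_cong)
  have PQ: "P \<otimes>\<^bsub>G\<^esub> Q \<in> N"
    unfolding P_def Q_def x_def by (rule double_commutator_mem[OF s tE y(1)])
  \<comment> \<open>The last commutator uses \<open>g = T k i \<one>\<close>. Conjugation by
    \<open>Q\<close> keeps its row and adds \<open>\<ominus> c\<close> at position \<open>j\<close>
    of its column, because \<open>b k = c\<close>.\<close>
  define f where "f = (\<lambda>l. axis k \<one> l \<oplus> axis j (\<ominus> c) l)"
  have fV: "f \<in> V" using cd by (auto simp: f_def)
  have fi: "f i = \<zero>" using ij k cd by (auto simp: f_def axis_apply)
  define g where "g = T k i \<one>"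
  have g: "g \<in> E" "g = dyad (axis k \<one>) (axis i \<one>)"
    unfolding g_def using ij k by (simp add: transvection_E, simp add: transvection_dyad)
  have PQG: "P \<in> carrier G" "Q \<in> carrier G"
    unfolding P Q using mV mi bV bj ij by (auto intro!: dyad_G simp: dot_axis dot_axis_left)
  have "P \<otimes>\<^bsub>G\<^esub> Q \<otimes>\<^bsub>G\<^esub> g \<otimes>\<^bsub>G\<^esub> inv\<^bsub>G\<^esub> (P \<otimes>\<^bsub>G\<^esub> Q)
    = P \<otimes>\<^bsub>G\<^esub> (Q \<otimes>\<^bsub>G\<^esub> g \<otimes>\<^bsub>G\<^esub> inv\<^bsub>G\<^esub> Q) \<otimes>\<^bsub>G\<^esub> inv\<^bsub>G\<^esub> P"
    using PQG g(1) by (simp add: G.m_assoc G.inv_mult_group)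
  moreover have "Q \<otimes>\<^bsub>G\<^esub> g \<otimes>\<^bsub>G\<^esub> inv\<^bsub>G\<^esub> Q = dyad f (axis i \<one>)"
    unfolding Q g(2) f_def using ij k bV bj cd
    by (subst conj_dyad_dyad) (auto simp: dot_axis dot_axis_left Pi_iff minus_eq axis_apply l_minus intro!: dyad_cong)
  \<comment> \<open>Both dyads have the row \<open>axis i \<one>\<close>, and their columns vanish
    at \<open>i\<close>; hence they commute.\<close>
  moreover have "P \<otimes>\<^bsub>G\<^esub> dyad f (axis i \<one>) \<otimes>\<^bsub>G\<^esub> inv\<^bsub>G\<^esub> P = dyad f (axis i \<one>)"
    unfolding P using ij k mV mi fV fi
    by (subst conj_dyad_dyad) (auto simp: dot_axis dot_axis_left Pi_iff minus_eq axis_apply intro!: dyad_cong)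
  ultimately have "P \<otimes>\<^bsub>G\<^esub> Q \<otimes>\<^bsub>G\<^esub> g \<otimes>\<^bsub>G\<^esub> inv\<^bsub>G\<^esub> (P \<otimes>\<^bsub>G\<^esub> Q) = dyad f (axis i \<one>)"
    by simp
  moreover have "dyad f (axis i \<one>) = T j i (\<ominus> c) \<otimes>\<^bsub>G\<^esub> g"
    unfolding g(2) f_def using ij k cd
    by (subst transvection_dyad) (auto simp: dyad_mult_left dot_axis axis_apply a_comm intro!: dyad_cong)
  \<comment> \<open>The commutator of \<open>P Q\<close> and \<open>g\<close> is thus a single
    transvection, once \<open>g\<close> cancels.\<close>
  ultimately have "T j i (\<ominus> c) \<otimes>\<^bsub>G\<^esub> g \<otimes>\<^bsub>G\<^esub> inv\<^bsub>G\<^esub> g \<in> N"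
    using commutator_mem(2)[OF g(1) PQ] by simp
  then have "T j i (\<ominus> c) \<in> N"
    using g(1) ij cd by (simp add: G.m_assoc transvection_G)
  then have "\<ominus> c \<in> level"
    using ij cd by (intro levelI[of j i]) auto
  then have "\<ominus> (\<ominus> c) \<in> level"
    using ideal_level by (meson additive_subgroup.a_inv_closed ideal.axioms(1))
  then show ?thesis using cd by (simp add: c_def)
qed

end

section \<open>Suslin's decomposition\<close>

context cring_matrix
begin

text \<open>The Koszul relation \<open>v\<^sub>l e\<^sub>k - v\<^sub>k e\<^sub>l\<close>, the basic
  row orthogonal to \<open>v\<close>.\<close>

definition koszul :: "(nat \<Rightarrow> 'a) \<Rightarrow> nat \<Rightarrow> nat \<Rightarrow> nat \<Rightarrow> 'a" where
  "koszul v k l = (\<lambda>m. axis k (v l) m \<oplus> axis l (\<ominus> v k) m)"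

lemma koszul_closed: "\<lbrakk>v \<in> V; k < n; l < n\<rbrakk> \<Longrightarrow> koszul v k l \<in> V"
  by (auto simp: koszul_def Pi_iff)

text \<open>Only the entries at \<open>k\<close> and \<open>l\<close> are paired, so
  \<open>p\<close> can be \<open>v\<close> itself or the part of \<open>v\<close> supported on these
  two indices.\<close>

lemma dot_koszul:
  assumes "v \<in> V" "k < n" "l < n" "p \<in> V" "p k = v k" "p l = v l"
  shows "dot (koszul v k l) p = \<zero>"
proof -
  have c: "v k \<in> carrier R" "v l \<in> carrier R" using assms by auto
  have "dot (koszul v k l) p = v l \<otimes> v k \<oplus> \<ominus> v k \<otimes> v l"
    unfolding koszul_def using assms c by (subst dot_add_left) (auto simp: dot_axis_left)
  also have "\<dots> = \<zero>" using c by algebra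
  finally show ?thesis .
qed

text \<open>For fixed \<open>k\<close> the sum is \<open>(u v) e\<^sub>k - v\<^sub>k u\<close>, and
  \<open>u v = 1\<close>.\<close>

lemma koszul_sum:
  assumes "u \<in> V" "v \<in> V" "dot u v = \<one>" "m < n" "k < n"
  shows "(\<Oplus>l\<in>{..<n}. u l \<otimes> koszul v k l m) = axis k \<one> m \<oplus> \<ominus> v k \<otimes> u m"
proof -
  have c: "v k \<in> carrier R" "u m \<in> carrier R" using assms by auto
  have "(\<Oplus>l\<in>{..<n}. u l \<otimes> koszul v k l m) = dot u (\<lambda>l. axis k \<one> m \<otimes> v l \<oplus> axis m (\<ominus> v k) l)"
    unfolding dot_def koszul_def using assms c
    by (intro finsum_cong') (auto simp: Pi_iff axis_apply)
  also have "\<dots> = axis k \<one> m \<oplus> \<ominus> v k \<otimes> u m"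
    using assms c by (subst dot_add) (auto simp: Pi_iff dot_smult dot_axis m_comm)
  finally show ?thesis .
qed

text \<open>Weighting \<open>koszul_sum\<close> by \<open>w k\<close> and summing over
  \<open>k\<close> gives \<open>w - (w v) u\<close>, which is \<open>w\<close> because
  \<open>w v = 0\<close>.\<close>

lemma koszul_expansion:
  assumes "u \<in> V" "v \<in> V" "w \<in> V" "dot u v = \<one>" "dot w v = \<zero>" "m < n"
  shows "w m = (\<Oplus>k\<in>{..<n}. \<Oplus>l\<in>{..<n}. (w k \<otimes> u l) \<otimes> koszul v k l m)"
proof -
  have c: "u m \<in> carrier R" using assms by auto
  have kc: "k < n \<Longrightarrow> l < n \<Longrightarrow> koszul v k l m \<in> carrier R" for k l
    using koszul_closed[OF assms(2)] assms(6) by (auto simp: Pi_iff)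
  have "(\<Oplus>k\<in>{..<n}. \<Oplus>l\<in>{..<n}. (w k \<otimes> u l) \<otimes> koszul v k l m)
      = (\<Oplus>k\<in>{..<n}. w k \<otimes> (\<Oplus>l\<in>{..<n}. u l \<otimes> koszul v k l m))"
    using assms kc
    by (intro finsum_cong' refl, simp_all add: Pi_iff finsum_closed)
       (subst finsum_rdistr, auto simp: Pi_iff m_assoc intro!: finsum_cong')
  also have "\<dots> = dot w (\<lambda>k. axis m \<one> k \<oplus> \<ominus> u m \<otimes> v k)"
    unfolding dot_def using assms c
    by (intro finsum_cong') (auto simp: koszul_sum Pi_iff axis_apply l_minus r_minus m_comm)
  also have "\<dots> = w m"
    using assms c by (subst dot_add) (auto simp: Pi_iff dot_smult dot_axis)
  finally show ?thesis by simp
qed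

end

context E_normalized
begin

text \<open>Congruence modulo \<open>N\<close>; only the right-hand side has to be elementary, so that \<open>N \<subseteq> E\<close> is not needed.\<close>

definition ncong :: "'a mat \<Rightarrow> 'a mat \<Rightarrow> bool" where
  "ncong a b \<longleftrightarrow> b \<in> E \<and> (\<exists>h\<in>N. a = h \<otimes>\<^bsub>G\<^esub> b)"

lemma ncong_refl: "a \<in> E \<Longrightarrow> ncong a a"
  unfolding ncong_def by (auto intro!: bexI[of _ "\<one>\<^bsub>G\<^esub>"])

lemma ncong_one: "a \<in> N \<Longrightarrow> ncong a \<one>\<^bsub>G\<^esub>"
  unfolding ncong_def by (auto intro!: bexI[of _ a])

text \<open>Write \<open>h b k d = h (b k b\<^sup>-\<^sup>1) (b d)\<close>. The conjugate lies in
  \<open>N\<close> because \<open>b\<close> is elementary, which is why \<open>ncong\<close> demands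
  this of its right-hand side.\<close>

lemma ncong_mult:
  assumes "ncong a b" "ncong c d"
  shows "ncong (a \<otimes>\<^bsub>G\<^esub> c) (b \<otimes>\<^bsub>G\<^esub> d)"
proof -
  from assms obtain h k where h: "h \<in> N" "a = h \<otimes>\<^bsub>G\<^esub> b" "b \<in> E" and k: "k \<in> N" "c = k \<otimes>\<^bsub>G\<^esub> d" "d \<in> E"
    unfolding ncong_def by auto
  have "a \<otimes>\<^bsub>G\<^esub> c = h \<otimes>\<^bsub>G\<^esub> (b \<otimes>\<^bsub>G\<^esub> k \<otimes>\<^bsub>G\<^esub> inv\<^bsub>G\<^esub> b) \<otimes>\<^bsub>G\<^esub> (b \<otimes>\<^bsub>G\<^esub> d)"
    using h k by (simp add: G.m_assoc G.inv_solve_left)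
  moreover have "h \<otimes>\<^bsub>G\<^esub> (b \<otimes>\<^bsub>G\<^esub> k \<otimes>\<^bsub>G\<^esub> inv\<^bsub>G\<^esub> b) \<in> N"
    using h k E_conj by auto
  ultimately show ?thesis
    unfolding ncong_def using h k by auto
qed

lemma ncong_inv:
  assumes "ncong a b"
  shows "ncong (inv\<^bsub>G\<^esub> a) (inv\<^bsub>G\<^esub> b)"
proof -
  from assms obtain h where h: "h \<in> N" "a = h \<otimes>\<^bsub>G\<^esub> b" "b \<in> E"
    unfolding ncong_def by auto
  have "inv\<^bsub>G\<^esub> a = (inv\<^bsub>G\<^esub> b \<otimes>\<^bsub>G\<^esub> inv\<^bsub>G\<^esub> h \<otimes>\<^bsub>G\<^esub> inv\<^bsub>G\<^esub> (inv\<^bsub>G\<^esub> b)) \<otimes>\<^bsub>G\<^esub> inv\<^bsub>G\<^esub> b"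
    using h by (simp add: G.m_assoc G.inv_mult_group)
  moreover have "inv\<^bsub>G\<^esub> b \<otimes>\<^bsub>G\<^esub> inv\<^bsub>G\<^esub> h \<otimes>\<^bsub>G\<^esub> inv\<^bsub>G\<^esub> (inv\<^bsub>G\<^esub> b) \<in> N"
    using h by (intro E_conj) auto
  ultimately show ?thesis
    unfolding ncong_def using h by auto
qed

end

section \<open>Koszul factors with coefficients in the ideal\<close>

locale E_normalized_over = E_normalized +
  fixes I
  assumes ideal_I: "ideal I R"
    and transvection_N: "\<And>i j x. \<lbrakk>i < n; j < n; i \<noteq> j; x \<in> I\<rbrakk> \<Longrightarrow> T i j x \<in> N"
begin

sublocale I: ideal I R by (rule ideal_I)

lemma ncong_transvection_left:
  assumes "i < n" "j < n" "i \<noteq> j" "x \<in> I" "g \<in> E"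
  shows "ncong (T i j x \<otimes>\<^bsub>G\<^esub> g) g" "ncong (g \<otimes>\<^bsub>G\<^esub> T i j x) g"
  using ncong_mult[OF ncong_one[OF transvection_N[OF assms(1-4)]] ncong_refl[OF assms(5)]]
    ncong_mult[OF ncong_refl[OF assms(5)] ncong_one[OF transvection_N[OF assms(1-4)]]] assms(5)
  by simp_all

text \<open>Since \<open>v\<close> vanishes at \<open>k\<close> and \<open>l\<close>, the row can be
  split into its two axes. Each factor is then a product of transvections with parameters in
  \<open>I\<close>.\<close>

lemma koszul_outer_mem:
  assumes v: "v \<in> V" "v k = \<zero>" "v l = \<zero>" and k: "k < n" "l < n"
    and I: "\<And>m. m < n \<Longrightarrow> v m \<in> I" and a: "a \<in> carrier R" "b \<in> carrier R"
  shows "dyad v (\<lambda>m. axis k a m \<oplus> axis l b m) \<in> N"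
proof -
  have "dyad v (axis s c) \<in> N" if "s < n" "c \<in> carrier R" "v s = \<zero>" for s c
    unfolding dyad_axis[OF v(1) that(2)] using that v I
    by (intro dyad_column_mem subgroup_N transvection_N) (auto simp: Pi_iff intro: I.I_l_closed)
  then have "dyad v (axis k a) \<otimes>\<^bsub>G\<^esub> dyad v (axis l b) \<in> N"
    using assms by (intro N.m_closed) auto
  then show ?thesis
    using assms by (subst (asm) dyad_mult_right) (auto simp: dot_axis_left)
qed

text \<open>The column is split into its entries off \<open>{k, l}\<close>, whose factor lies in
  \<open>N\<close>, and its entries at \<open>k\<close> and \<open>l\<close>. The condition is put
  on the products \<open>y \<otimes> v m\<close> so that it covers both \<open>y \<in> I\<close> and
  \<open>v m \<in> I\<close>.\<close>

lemma koszul_split: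
  assumes v: "v \<in> V" and k: "k < n" "l < n" "k \<noteq> l" and y: "y \<in> carrier R"
    and I: "\<And>m. \<lbrakk>m < n; m \<noteq> k; m \<noteq> l\<rbrakk> \<Longrightarrow> y \<otimes> v m \<in> I"
  obtains h where "h \<in> N"
    "dyad (\<lambda>m. y \<otimes> v m) (koszul v k l) = h \<otimes>\<^bsub>G\<^esub> dyad (\<lambda>m. y \<otimes> (axis k (v k) m \<oplus> axis l (v l) m)) (koszul v k l)"
proof
  let ?p = "\<lambda>m. axis k (v k) m \<oplus> axis l (v l) m"
  let ?v' = "\<lambda>m. if m = k \<or> m = l then \<zero> else y \<otimes> v m"
  have c: "v k \<in> carrier R" "v l \<in> carrier R" using v k by auto
  have pV: "?p \<in> V" "(\<lambda>m. y \<otimes> ?p m) \<in> V" using c y by auto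
  have v'V: "?v' \<in> V" using v y by (auto simp: Pi_iff)
  show "dyad ?v' (koszul v k l) \<in> N"
    unfolding koszul_def using v k y I c v'V
    by (intro koszul_outer_mem) auto
  have "dot (koszul v k l) ?p = \<zero>"
    using v k c pV by (intro dot_koszul) (auto simp: axis_apply)
  then have d: "dot (koszul v k l) (\<lambda>m. y \<otimes> ?p m) = \<zero>"
    using koszul_closed[OF v k(1,2)] pV y by (simp add: dot_smult)
  show "dyad (\<lambda>m. y \<otimes> v m) (koszul v k l) = dyad ?v' (koszul v k l) \<otimes>\<^bsub>G\<^esub> dyad (\<lambda>m. y \<otimes> ?p m) (koszul v k l)"
    unfolding dyad_mult_left[OF v'V pV(2) koszul_closed[OF v k(1,2)] d]
    using v y k by (intro dyad_cong) (auto simp: axis_apply Pi_iff)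
qed

text \<open>An instance of \<open>dyad_commutator\<close> with a third index \<open>r\<close>. Both
  factors are spelled out as transvections, so that each can be compared with \<open>N\<close>
  separately.\<close>

lemma koszul_inner:
  assumes v: "v \<in> V" and k: "k < n" "l < n" "k \<noteq> l" and r: "r < n" "r \<noteq> k" "r \<noteq> l" and y: "y \<in> carrier R"
  defines "A \<equiv> T k r (v k) \<otimes>\<^bsub>G\<^esub> T l r (v l)"
    and "B \<equiv> T r k (y \<otimes> v l) \<otimes>\<^bsub>G\<^esub> T r l (y \<otimes> \<ominus> v k)"
  shows "dyad (\<lambda>m. y \<otimes> (axis k (v k) m \<oplus> axis l (v l) m)) (koszul v k l)
    = inv\<^bsub>G\<^esub> B \<otimes>\<^bsub>G\<^esub> (A \<otimes>\<^bsub>G\<^esub> B \<otimes>\<^bsub>G\<^esub> inv\<^bsub>G\<^esub> A)"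
proof -
  let ?p = "\<lambda>m. axis k (v k) m \<oplus> axis l (v l) m"
  have c: "v k \<in> carrier R" "v l \<in> carrier R" using v k by auto
  have pV: "?p \<in> V" using c by auto
  have d: "dot (koszul v k l) ?p = \<zero>"
    using v k c pV by (intro dot_koszul) (auto simp: axis_apply)
  have "A = dyad ?p (axis r \<one>)"
    unfolding A_def transvection_dyad[OF k(1) r(1) c(1)] transvection_dyad[OF k(2) r(1) c(2)]
    using k r c by (subst dyad_mult_left) (auto simp: dot_axis axis_apply)
  moreover have "B = dyad (axis r y) (koszul v k l)"
    unfolding B_def koszul_def using k r c y by (subst dyad_axis_pair) auto
  moreover have "?p r = \<zero>" "koszul v k l r = \<zero>"
    using k r c by (auto simp: koszul_def axis_apply)
  ultimately show ?thesis
    using dyad_commutator[OF pV koszul_closed[OF v k(1,2)] d r(1) _ _ y] by simp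
qed

text \<open>For \<open>k = l\<close> the Koszul row is zero. Otherwise the parameters of
  \<open>B\<close> are multiples of \<open>y\<close>, so \<open>B \<in> N\<close>, and its
  commutator with the elementary \<open>A\<close> stays in \<open>N\<close>.\<close>

lemma koszul_mem:
  assumes v: "v \<in> V" and k: "k < n" "l < n" and y: "y \<in> I"
  shows "dyad (\<lambda>m. y \<otimes> v m) (koszul v k l) \<in> N"
proof (cases "k = l")
  case True
  have yc: "y \<in> carrier R" using y by (rule I.Icarr)
  have "dyad (\<lambda>m. y \<otimes> v m) (koszul v k l) = dyad (\<lambda>m. y \<otimes> v m) (\<lambda>_. \<zero>)"
    using True v k by (intro dyad_cong) (auto simp: koszul_def axis_apply r_neg Pi_iff)
  also have "\<dots> = \<one>\<^bsub>G\<^esub>"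
    using v yc by (simp add: G_simps dyad_zero_right Pi_iff)
  finally show ?thesis by simp
next
  case False
  have yc: "y \<in> carrier R" using y by (rule I.Icarr)
  have c: "v k \<in> carrier R" "v l \<in> carrier R" using v k by auto
  obtain r where r: "r < n" "r \<noteq> k" "r \<noteq> l" by (rule third_index)
  define A where "A = T k r (v k) \<otimes>\<^bsub>G\<^esub> T l r (v l)"
  define B where "B = T r k (y \<otimes> v l) \<otimes>\<^bsub>G\<^esub> T r l (y \<otimes> \<ominus> v k)"
  obtain h where h: "h \<in> N" "dyad (\<lambda>m. y \<otimes> v m) (koszul v k l)
      = h \<otimes>\<^bsub>G\<^esub> dyad (\<lambda>m. y \<otimes> (axis k (v k) m \<oplus> axis l (v l) m)) (koszul v k l)"
    using koszul_split[OF v k False yc] v y by (auto simp: Pi_iff intro: I.I_r_closed)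
  have "A \<in> E"
    unfolding A_def using k r c by (intro E.m_closed transvection_E) auto
  moreover have "B \<in> N"
    unfolding B_def using k r c y by (intro N.m_closed transvection_N I.I_r_closed) auto
  ultimately have "inv\<^bsub>G\<^esub> B \<otimes>\<^bsub>G\<^esub> (A \<otimes>\<^bsub>G\<^esub> B \<otimes>\<^bsub>G\<^esub> inv\<^bsub>G\<^esub> A) \<in> N"
    by (rule commutator_mem)
  then show ?thesis
    using h koszul_inner[OF v k False r yc] by (simp add: A_def B_def)
qed

text \<open>As \<open>v j \<in> I\<close>, one transvection in each of \<open>A\<close> and
  \<open>B\<close> disappears modulo \<open>N\<close>. What remains is the Steinberg commutator of
  \<open>T i r (v i)\<close> and \<open>T r j (y \<otimes> v i)\<close>.\<close>

lemma koszul_ncong: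
  assumes v: "v \<in> V" and ij: "i < n" "j < n" "i \<noteq> j" and y: "y \<in> carrier R"
    and I: "\<And>m. \<lbrakk>m < n; m \<noteq> i\<rbrakk> \<Longrightarrow> v m \<in> I"
  shows "ncong (dyad (\<lambda>m. y \<otimes> v m) (koszul v j i)) (T i j (v i \<otimes> (y \<otimes> v i)))"
proof -
  have c: "v i \<in> carrier R" "v j \<in> carrier R" using v ij by auto
  have vj: "v j \<in> I" "y \<otimes> \<ominus> v j \<in> I"
    using I ij y by (auto intro: I.I_l_closed I.a_inv_closed)
  obtain r where r: "r < n" "r \<noteq> i" "r \<noteq> j" by (rule third_index)
  define A where "A = T j r (v j) \<otimes>\<^bsub>G\<^esub> T i r (v i)"
  define B where "B = T r j (y \<otimes> v i) \<otimes>\<^bsub>G\<^esub> T r i (y \<otimes> \<ominus> v j)"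
  obtain h where h: "h \<in> N" "dyad (\<lambda>m. y \<otimes> v m) (koszul v j i)
      = h \<otimes>\<^bsub>G\<^esub> dyad (\<lambda>m. y \<otimes> (axis j (v j) m \<oplus> axis i (v i) m)) (koszul v j i)"
    using koszul_split[OF v ij(2,1) ij(3)[symmetric] y] I y by (auto intro: I.I_l_closed)
  have A: "ncong A (T i r (v i))"
    unfolding A_def using ij r c vj by (intro ncong_transvection_left transvection_E) auto
  have B: "ncong B (T r j (y \<otimes> v i))"
    unfolding B_def using ij r c y vj by (intro ncong_transvection_left transvection_E) auto
  have "ncong (inv\<^bsub>G\<^esub> B \<otimes>\<^bsub>G\<^esub> (A \<otimes>\<^bsub>G\<^esub> B \<otimes>\<^bsub>G\<^esub> inv\<^bsub>G\<^esub> A)) (T i j (v i \<otimes> (y \<otimes> v i)))"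
    using transvection_commutator[OF ij(1,2) r(1) ij(3) r(2,3) c(1) m_closed[OF y c(1)]]
      ncong_mult[OF ncong_inv[OF B] ncong_mult[OF ncong_mult[OF A B] ncong_inv[OF A]]] by simp
  then show ?thesis
    using ncong_mult[OF ncong_one[OF h(1)]] h(2) koszul_inner[OF v ij(2,1) ij(3)[symmetric] r(1,3,2) y]
      transvection_G[OF ij m_closed[OF c(1) m_closed[OF y c(1)]]]
    by (fastforce simp: A_def B_def)
qed

lemma ncong_transvection_mod:
  assumes "i < n" "j < n" "i \<noteq> j" "x \<in> carrier R" "z \<in> carrier R" "z \<ominus> x \<in> I" "ncong a (T i j z)"
  shows "ncong a (T i j x)"
proof -
  obtain h where h: "h \<in> N" "a = h \<otimes>\<^bsub>G\<^esub> T i j z" using assms(7) by (auto simp: ncong_def)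
  have "z = (z \<ominus> x) \<oplus> x" using assms(4,5) by (simp add: minus_eq a_assoc l_neg)
  then have "T i j z = T i j (z \<ominus> x) \<otimes>\<^bsub>G\<^esub> T i j x"
    using transvection_add[of i j "z \<ominus> x" x] assms by simp
  then have "a = (h \<otimes>\<^bsub>G\<^esub> T i j (z \<ominus> x)) \<otimes>\<^bsub>G\<^esub> T i j x"
    using h assms by (simp add: G.m_assoc transvection_G)
  moreover have "h \<otimes>\<^bsub>G\<^esub> T i j (z \<ominus> x) \<in> N"
    using h assms by (intro N.m_closed transvection_N)
  ultimately show ?thesis
    unfolding ncong_def using assms by (auto simp: transvection_E)
qed

text \<open>In Suslin's expansion of \<open>w\<close>, a coefficient
  \<open>w k \<otimes> u l\<close> lies in \<open>I\<close> unless \<open>(k, l) = (j, i)\<close>.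
  The exceptional factor is congruent to \<open>T i j z\<close> with
  \<open>z = w\<^sub>j u\<^sub>i v\<^sub>i\<^sup>2 x\<close>, and the last assumption makes
  \<open>z\<close> congruent to \<open>x\<close> modulo \<open>I\<close>.\<close>

lemma dyad_ncong_transvection:
  assumes V: "u \<in> V" "v \<in> V" "w \<in> V" and d: "dot u v = \<one>" "dot w v = \<zero>"
    and ij: "i < n" "j < n" "i \<noteq> j" and x: "x \<in> carrier R"
    and vI: "\<And>m. \<lbrakk>m < n; m \<noteq> i\<rbrakk> \<Longrightarrow> v m \<in> I"
    and uI: "\<And>m. \<lbrakk>m < n; m \<noteq> i\<rbrakk> \<Longrightarrow> u m \<in> I"
    and wI: "\<And>m. \<lbrakk>m < n; m \<noteq> j\<rbrakk> \<Longrightarrow> w m \<in> I"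
    and c1: "w j \<otimes> u i \<otimes> (v i \<otimes> v i) \<ominus> \<one> \<in> I"
  shows "ncong (dyad (\<lambda>m. x \<otimes> v m) w) (T i j x)"
proof -
  let ?xv = "\<lambda>m. x \<otimes> v m"
  have xv: "?xv \<in> V" using V x by (auto simp: Pi_iff)
  have cl: "\<And>m. m < n \<Longrightarrow> u m \<in> carrier R" "\<And>m. m < n \<Longrightarrow> v m \<in> carrier R" "\<And>m. m < n \<Longrightarrow> w m \<in> carrier R"
    using V by auto
  define f where "f = (\<lambda>k l m. (w k \<otimes> u l) \<otimes> koszul v k l m)"
  have fV: "f k l \<in> V" if "k < n" "l < n" for k l
    using that cl koszul_closed[OF V(2) that] by (auto simp: f_def Pi_iff)
  have f0: "dot (f k l) ?xv = \<zero>" if "k < n" "l < n" for k l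
    using that cl V x koszul_closed[OF V(2) that] dot_koszul[OF V(2) that V(2)]
    by (simp add: f_def dot_smult dot_smult_left xv)
  have fd: "dyad ?xv (f k l) = dyad (\<lambda>m. (w k \<otimes> u l \<otimes> x) \<otimes> v m) (koszul v k l)" if "k < n" "l < n" for k l
    unfolding f_def using that cl x xv koszul_closed[OF V(2) that]
    by (subst dyad_scale) (auto intro!: dyad_cong simp: m_assoc)
  have fN: "dyad ?xv (f k l) \<in> N" if "k < n" "l < n" "k \<noteq> j \<or> l \<noteq> i" for k l
  proof -
    have "w k \<otimes> u l \<in> I" using that wI uI cl by (auto intro: I.I_l_closed I.I_r_closed)
    then show ?thesis
      unfolding fd[OF that(1,2)] using that V x by (intro koszul_mem I.I_r_closed[of "w k \<otimes> u l"])
  qed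
  define F where "F = (\<lambda>k m. \<Oplus>l\<in>{..<n}. f k l m)"
  have FV: "F k \<in> V" if "k < n" for k
    using that fV by (auto simp: F_def Pi_iff intro!: finsum_closed)
  have sum0: "dot (\<lambda>m. \<Oplus>s\<in>S. g s m) ?xv = \<zero>"
    if "finite S" "\<And>s. s \<in> S \<Longrightarrow> g s \<in> V" "\<And>s. s \<in> S \<Longrightarrow> dot (g s) ?xv = \<zero>" for S :: "nat set" and g
    using that
  proof (induction S rule: finite_induct)
    case empty
    have "dot (\<lambda>m. \<zero>) ?xv = (\<Oplus>k\<in>{..<n}. \<zero>)"
      unfolding dot_def using V x by (intro finsum_cong') (auto simp: Pi_iff)
    then show ?case by simp
  next
    case (insert a S)
    have gV: "(\<lambda>m. \<Oplus>s\<in>S. g s m) \<in> V"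
      using insert by (auto simp: Pi_iff intro!: finsum_closed)
    have "dot (\<lambda>m. \<Oplus>s\<in>insert a S. g s m) ?xv = dot (\<lambda>m. g a m \<oplus> (\<Oplus>s\<in>S. g s m)) ?xv"
      using insert xv gV by (intro dot_cong refl finsum_insert) (auto simp: Pi_iff)
    then show ?case using insert gV xv by (simp add: dot_add_left)
  qed
  have F0: "dot (F k) ?xv = \<zero>" if "k < n" for k
    unfolding F_def using that fV f0 by (intro sum0) auto
  have FN: "dyad ?xv (F k) \<in> N" if "k < n" "k \<noteq> j" for k
    unfolding F_def using that fV f0 fN xv by (intro dyad_sum_mem subgroup_N) auto
  \<comment> \<open>The exceptional term is isolated in two stages: \<open>W\<close> collects the
    terms with \<open>k \<noteq> j\<close>, and \<open>U\<close> those with \<open>k = j\<close> and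
    \<open>l \<noteq> i\<close>.\<close>
  have ins: "{..<n} = insert j ({..<n} - {j})" "{..<n} = insert i ({..<n} - {i})"
    using ij by auto
  define U where "U = (\<lambda>m. \<Oplus>l\<in>{..<n} - {i}. f j l m)"
  define W where "W = (\<lambda>m. \<Oplus>k\<in>{..<n} - {j}. F k m)"
  have UV: "U \<in> V" and WV: "W \<in> V"
    unfolding U_def W_def using fV FV ij by (auto simp: Pi_iff intro!: finsum_closed)
  have UN: "dyad ?xv U \<in> N"
    unfolding U_def using fV f0 fN xv ij by (intro dyad_sum_mem subgroup_N) auto
  have WN: "dyad ?xv W \<in> N"
    unfolding W_def using FV F0 FN xv ij by (intro dyad_sum_mem subgroup_N) auto
  have Fj: "F j m = f j i m \<oplus> U m" if "m < n" for m
    unfolding F_def U_def using fV ij that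
    by (subst ins(2), subst finsum_insert) (auto simp: Pi_iff)
  have w: "w m = F j m \<oplus> W m" if "m < n" for m
  proof -
    have "w m = (\<Oplus>k\<in>{..<n}. F k m)"
      unfolding F_def f_def using koszul_expansion[OF V d that] .
    also have "\<dots> = F j m \<oplus> W m"
      unfolding W_def using FV ij that
      by (subst ins(1), subst finsum_insert) (auto simp: Pi_iff)
    finally show ?thesis .
  qed
  have "dyad ?xv w = dyad ?xv (\<lambda>m. F j m \<oplus> W m)"
    using w by (intro dyad_cong) auto
  also have "\<dots> = dyad ?xv (F j) \<otimes>\<^bsub>G\<^esub> dyad ?xv W"
    using xv FV F0 WV ij by (intro dyad_mult_right[symmetric]) auto
  also have "dyad ?xv (F j) = dyad ?xv (\<lambda>m. f j i m \<oplus> U m)"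
    using Fj by (intro dyad_cong) auto
  also have "\<dots> = dyad ?xv (f j i) \<otimes>\<^bsub>G\<^esub> dyad ?xv U"
    using xv fV f0 UV ij by (intro dyad_mult_right[symmetric]) auto
  finally have eq: "dyad ?xv w = dyad ?xv (f j i) \<otimes>\<^bsub>G\<^esub> dyad ?xv U \<otimes>\<^bsub>G\<^esub> dyad ?xv W" .
  define c where "c = w j \<otimes> u i"
  have c: "c \<in> carrier R" "v i \<in> carrier R" using cl ij by (auto simp: c_def)
  define z where "z = v i \<otimes> (c \<otimes> x \<otimes> v i)"
  have z: "z \<in> carrier R" using c x by (simp add: z_def)
  have "ncong (dyad ?xv (f j i)) (T i j z)"
    unfolding fd[OF ij(2,1)] z_def c_def[symmetric]
    using V ij x c vI by (intro koszul_ncong) auto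
  then have "ncong (dyad ?xv w) (T i j z \<otimes>\<^bsub>G\<^esub> \<one>\<^bsub>G\<^esub> \<otimes>\<^bsub>G\<^esub> \<one>\<^bsub>G\<^esub>)"
    unfolding eq by (intro ncong_mult ncong_one UN WN)
  then have "ncong (dyad ?xv w) (T i j z)"
    using transvection_G[OF ij z] by simp
  moreover have "z \<ominus> x = x \<otimes> (c \<otimes> (v i \<otimes> v i) \<ominus> \<one>)"
    unfolding z_def using c x by algebra
  then have "z \<ominus> x \<in> I"
    using c1 x by (simp add: c_def I.I_l_closed)
  ultimately show ?thesis
    using ij x z by (intro ncong_transvection_mod[of i j x z]) auto
qed

end

section \<open>Congruence subgroups\<close>

context cring_matrix
begin

lemma scalar_mult_entry:
  assumes "z \<in> carrier M" "g \<in> carrier M" "i < n" "j < n"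
    and "\<And>k. \<lbrakk>k < n; k \<noteq> i\<rbrakk> \<Longrightarrow> z $$ (i, k) = \<zero>"
  shows "(z \<otimes>\<^bsub>M\<^esub> g) $$ (i, j) = z $$ (i, i) \<otimes> g $$ (i, j)"
proof -
  have "(z \<otimes>\<^bsub>M\<^esub> g) $$ (i, j) = dot (axis i (z $$ (i, i))) (\<lambda>k. g $$ (k, j))"
    unfolding mult_entry[OF assms(3,4)] using assms mat_memD(4)[OF assms(1)] mat_memD(4)[OF assms(2)]
    by (intro dot_cong) (auto simp: axis_apply Pi_iff)
  then show ?thesis
    using assms mat_memD(4)[OF assms(1)] col_closed[OF assms(2,4)] by (simp add: dot_axis_left)
qed

lemma mult_scalar_entry:
  assumes "z \<in> carrier M" "g \<in> carrier M" "i < n" "j < n"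
    and "\<And>k. \<lbrakk>k < n; k \<noteq> j\<rbrakk> \<Longrightarrow> z $$ (k, j) = \<zero>"
  shows "(g \<otimes>\<^bsub>M\<^esub> z) $$ (i, j) = g $$ (i, j) \<otimes> z $$ (j, j)"
proof -
  have "(g \<otimes>\<^bsub>M\<^esub> z) $$ (i, j) = dot (\<lambda>k. g $$ (i, k)) (axis j (z $$ (j, j)))"
    unfolding mult_entry[OF assms(3,4)] using assms mat_memD(4)[OF assms(1)] mat_memD(4)[OF assms(2)]
    by (intro dot_cong) (auto simp: axis_apply Pi_iff)
  then show ?thesis
    using assms mat_memD(4)[OF assms(1)] row_closed[OF assms(2,3)] by (simp add: dot_axis)
qed

text \<open>Comparing column \<open>i\<close> in
  \<open>z t\<^sub>j\<^sub>i(1) = t\<^sub>j\<^sub>i(1) z\<close> shows that column \<open>j\<close>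
  of \<open>z\<close> is \<open>z\<^sub>i\<^sub>i e\<^sub>j\<close>, so elementary matrices already
  detect the center. The zero ring is included, which covers the quotient by
  \<open>I = R\<close>.\<close>

lemma center_iff:
  assumes z: "z \<in> carrier G"
  shows "z \<in> group_center G \<longleftrightarrow>
    (\<forall>i<n. \<forall>j<n. i \<noteq> j \<longrightarrow> z $$ (i, j) = \<zero> \<and> z $$ (i, i) = z $$ (j, j))"
proof
  assume c: "z \<in> group_center G"
  have zM: "z \<in> carrier M" using z by (rule G_M)
  note zc = mat_memD(4)[OF zM]
  show "\<forall>i<n. \<forall>j<n. i \<noteq> j \<longrightarrow> z $$ (i, j) = \<zero> \<and> z $$ (i, i) = z $$ (j, j)"
  proof (intro allI impI)
    fix i j assume ij: "i < n" "j < n" "i \<noteq> j"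
    have V: "axis j \<one> \<in> V" "axis i \<one> \<in> V" by auto
    have comm: "z \<otimes>\<^bsub>M\<^esub> T j i \<one> = T j i \<one> \<otimes>\<^bsub>M\<^esub> z"
      using c transvection_G[OF ij(2,1) _ one_closed] ij(3) unfolding group_center_def G_simps(1) by auto
    have "z $$ (k, j) = axis j \<one> k \<otimes> z $$ (i, i)" if k: "k < n" for k
    proof -
      have "(z \<otimes>\<^bsub>M\<^esub> T j i \<one>) $$ (k, i) = z $$ (k, i) \<oplus> z $$ (k, j)"
        unfolding transvection_dyad[OF ij(2,1) one_closed] using ij k zM zc V row_closed[OF zM k]
        by (simp add: mult_dyad_entry mat_vec_def dot_axis axis_apply)
      moreover have "(T j i \<one> \<otimes>\<^bsub>M\<^esub> z) $$ (k, i) = dot (\<lambda>m. axis k \<one> m \<oplus> axis j \<one> k \<otimes> axis i \<one> m) (\<lambda>m. z $$ (m, i))"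
        unfolding transvection_dyad[OF ij(2,1) one_closed] mult_entry[OF k ij(1)] using ij k zc V
        by (intro dot_cong) (auto simp: Pi_iff dyad_entry axis_apply)
      moreover have "\<dots> = z $$ (k, i) \<oplus> axis j \<one> k \<otimes> z $$ (i, i)"
        using ij k zc V col_closed[OF zM ij(1)]
        by (subst dot_add_left) (auto simp: Pi_iff dot_smult_left dot_axis_left)
      ultimately have "z $$ (k, i) \<oplus> z $$ (k, j) = z $$ (k, i) \<oplus> axis j \<one> k \<otimes> z $$ (i, i)"
        using comm by simp
      then show ?thesis
        using ij k zc by (subst (asm) add.l_cancel) auto
    qed
    from this[OF ij(1)] this[OF ij(2)] show "z $$ (i, j) = \<zero> \<and> z $$ (i, i) = z $$ (j, j)"
      using ij zc by (simp add: axis_apply)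
  qed
next
  assume s: "\<forall>i<n. \<forall>j<n. i \<noteq> j \<longrightarrow> z $$ (i, j) = \<zero> \<and> z $$ (i, i) = z $$ (j, j)"
  have zM: "z \<in> carrier M" using z by (rule G_M)
  have "z \<otimes>\<^bsub>M\<^esub> g = g \<otimes>\<^bsub>M\<^esub> z" if "g \<in> carrier G" for g
  proof (rule M_eqI)
    fix i j assume ij: "i < n" "j < n"
    have gM: "g \<in> carrier M" using that by (rule G_M)
    have "z $$ (i, i) = z $$ (j, j)" using s ij by metis
    then show "(z \<otimes>\<^bsub>M\<^esub> g) $$ (i, j) = (g \<otimes>\<^bsub>M\<^esub> z) $$ (i, j)"
      using s ij zM gM mat_memD(4)[OF zM] mat_memD(4)[OF gM]
      by (simp add: scalar_mult_entry mult_scalar_entry m_comm)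
  qed (simp_all add: mult_dim)
  then show "z \<in> group_center G"
    using z by (simp add: group_center_def G_simps)
qed

end

lemma group_center_inv:
  assumes "group G" "z \<in> group_center G"
  shows "inv\<^bsub>G\<^esub> z \<in> group_center G"
proof -
  interpret group G by fact
  have z: "z \<in> carrier G" "\<And>g. g \<in> carrier G \<Longrightarrow> z \<otimes>\<^bsub>G\<^esub> g = g \<otimes>\<^bsub>G\<^esub> z"
    using assms(2) by (auto simp: group_center_def)
  have "inv\<^bsub>G\<^esub> z \<otimes>\<^bsub>G\<^esub> g = g \<otimes>\<^bsub>G\<^esub> inv\<^bsub>G\<^esub> z" if "g \<in> carrier G" for g
  proof -
    have "inv\<^bsub>G\<^esub> (z \<otimes>\<^bsub>G\<^esub> inv\<^bsub>G\<^esub> g) = inv\<^bsub>G\<^esub> (inv\<^bsub>G\<^esub> g \<otimes>\<^bsub>G\<^esub> z)"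
      using z(2)[of "inv\<^bsub>G\<^esub> g"] that by simp
    then show ?thesis using that z(1) by (simp add: inv_mult_group)
  qed
  then show ?thesis using z(1) by (simp add: group_center_def)
qed

section \<open>Entrywise ring homomorphisms\<close>

locale cring_matrix_hom = R: cring_matrix R n + S: cring_matrix S n + ring_hom_cring R S h
  for R (structure) and S (structure) and n and h
begin

lemma map_mat_entry: "\<lbrakk>A \<in> carrier R.M; i < n; j < n\<rbrakk> \<Longrightarrow> map_mat h A $$ (i, j) = h (A $$ (i, j))"
  using R.mat_memD(2,3)[of A] by simp

lemma map_mat_M: "A \<in> carrier R.M \<Longrightarrow> map_mat h A \<in> carrier S.M"
  by (intro S.mat_memI) (auto simp: map_mat_entry R.mat_memD(4) dest: R.mat_memD(1))

lemma map_mat_mult: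
  assumes "A \<in> carrier R.M" "B \<in> carrier R.M"
  shows "map_mat h (A \<otimes>\<^bsub>R.M\<^esub> B) = map_mat h A \<otimes>\<^bsub>S.M\<^esub> map_mat h B"
proof (rule S.M_eqI)
  fix i j assume ij: "i < n" "j < n"
  have "map_mat h (A \<otimes>\<^bsub>R.M\<^esub> B) $$ (i, j) = h (R.dot (\<lambda>k. A $$ (i, k)) (\<lambda>k. B $$ (k, j)))"
    using ij by (simp add: R.mult_dim R.mult_entry)
  also have "\<dots> = S.dot (\<lambda>k. h (A $$ (i, k))) (\<lambda>k. h (B $$ (k, j)))"
    unfolding R.dot_def S.dot_def using assms ij
    by (subst hom_finsum) (auto simp: R.mat_memD(4) intro!: S.finsum_cong')
  also have "\<dots> = (map_mat h A \<otimes>\<^bsub>S.M\<^esub> map_mat h B) $$ (i, j)"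
    unfolding S.mult_entry[OF ij] using assms ij
    by (intro S.dot_cong) (auto simp: map_mat_entry R.mat_memD(4))
  finally show "map_mat h (A \<otimes>\<^bsub>R.M\<^esub> B) $$ (i, j) = (map_mat h A \<otimes>\<^bsub>S.M\<^esub> map_mat h B) $$ (i, j)" .
qed (simp_all add: R.mult_dim S.mult_dim)

lemma map_mat_one: "map_mat h \<one>\<^bsub>R.M\<^esub> = \<one>\<^bsub>S.M\<^esub>"
  by (rule S.M_eqI) (simp_all add: R.one_dim S.one_dim R.one_entry S.one_entry)

lemma map_mat_G:
  assumes "A \<in> carrier R.G"
  shows "map_mat h A \<in> carrier S.G" "map_mat h (inv\<^bsub>R.G\<^esub> A) = inv\<^bsub>S.G\<^esub> (map_mat h A)"
proof -
  interpret GR: group R.G by (rule R.group_G)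
  let ?B = "inv\<^bsub>R.G\<^esub> A"
  have M: "A \<in> carrier R.M" "?B \<in> carrier R.M"
    using R.G_M[OF assms] R.G_M[OF GR.inv_closed[OF assms]] by auto
  have e: "map_mat h A \<otimes>\<^bsub>S.M\<^esub> map_mat h ?B = \<one>\<^bsub>S.M\<^esub>" "map_mat h ?B \<otimes>\<^bsub>S.M\<^esub> map_mat h A = \<one>\<^bsub>S.M\<^esub>"
    using GR.r_inv[OF assms] GR.l_inv[OF assms] M
    by (simp_all add: map_mat_mult[symmetric] map_mat_one R.G_simps)
  then show c: "map_mat h A \<in> carrier S.G"
    unfolding S.G_simps Units_def using map_mat_M[OF M(1)] map_mat_M[OF M(2)] by blast
  have "map_mat h ?B \<in> carrier S.G"
    unfolding S.G_simps Units_def using map_mat_M[OF M(1)] map_mat_M[OF M(2)] e by blast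
  then show "map_mat h ?B = inv\<^bsub>S.G\<^esub> (map_mat h A)"
    using group.inv_equality[OF S.group_G, of "map_mat h ?B" "map_mat h A"] e c by (simp add: S.G_simps)
qed

end

section \<open>Congruence subgroups in terms of matrix entries\<close>

context cring_matrix
begin

lemma quotient_hom:
  assumes "ideal I R"
  shows "cring_matrix_hom R (R Quot I) ((+>) I)"
  using ideal.rcos_ring_hom_cring[OF assms is_cring]
  by (intro cring_matrix_hom.intro cring_matrix.intro)
     (auto simp: ideal.quotient_is_cring[OF assms is_cring] is_cring)

lemma full_congruence_iff:
  assumes I: "ideal I R" and A: "A \<in> carrier G"
  shows "A \<in> full_congruence_subgroup n R I \<longleftrightarrow>
    (\<forall>i<n. \<forall>j<n. i \<noteq> j \<longrightarrow> A $$ (i, j) \<in> I \<and> A $$ (i, i) \<ominus> A $$ (j, j) \<in> I)"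
proof -
  interpret I: ideal I R by (rule I)
  interpret H: cring_matrix_hom R "R Quot I" n "(+>) I" by (rule quotient_hom[OF I])
  have AM: "A \<in> carrier M" using A by (rule G_M)
  have z: "I +> x = \<zero>\<^bsub>R Quot I\<^esub> \<longleftrightarrow> x \<in> I" if "x \<in> carrier R" for x
    using quotient_eq_iff_same_a_r_cos[OF I that zero_closed] H.hom_zero that by (simp add: minus_eq)
  show ?thesis
    unfolding full_congruence_subgroup_def using A H.map_mat_G(1)[OF A]
    by (simp add: H.S.center_iff H.map_mat_entry[OF AM] z mat_memD(4)[OF AM]
        quotient_eq_iff_same_a_r_cos[OF I, symmetric])
qed

text \<open>Modulo \<open>I\<close> both matrices are scalar, say \<open>a\<close> and
  \<open>b\<close> with \<open>a b = 1\<close>; the displayed product becomes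
  \<open>(a b)\<^sup>2\<close>. This is the congruence required by
  \<open>dyad_ncong_transvection\<close>.\<close>

lemma full_congruence_inverse:
  assumes I: "ideal I R" and A: "A \<in> full_congruence_subgroup n R I" and ij: "i < n" "j < n"
  defines "B \<equiv> inv\<^bsub>G\<^esub> A"
  shows "B \<in> full_congruence_subgroup n R I"
    and "B $$ (j, j) \<otimes> B $$ (i, i) \<otimes> (A $$ (i, i) \<otimes> A $$ (i, i)) \<ominus> \<one> \<in> I"
proof -
  interpret I: ideal I R by (rule I)
  interpret G: group G by (rule group_G)
  interpret H: cring_matrix_hom R "R Quot I" n "(+>) I" by (rule quotient_hom[OF I])
  have AG: "A \<in> carrier G" using A by (simp add: full_congruence_subgroup_def)
  have BG: "B \<in> carrier G" using AG by (simp add: B_def)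
  have AM: "A \<in> carrier M" "B \<in> carrier M" using AG BG G_M by auto
  note c = mat_memD(4)[OF AM(1)] mat_memD(4)[OF AM(2)]
  show BF: "B \<in> full_congruence_subgroup n R I"
    using A AG BG group_center_inv[OF H.S.group_G] H.map_mat_G(2)[OF AG]
    by (simp add: full_congruence_subgroup_def B_def)
  let ?A = "map_mat ((+>) I) A" and ?B = "map_mat ((+>) I) B"
  have GG: "?A \<in> carrier H.S.G" "?B \<in> carrier H.S.G" using H.map_mat_G(1) AG BG by auto
  have e: "?A \<otimes>\<^bsub>H.S.M\<^esub> ?B = \<one>\<^bsub>H.S.M\<^esub>"
    using G.r_inv[OF AG] AM by (simp add: H.map_mat_mult[symmetric] H.map_mat_one G_simps B_def)
  have center: "?A \<in> group_center H.S.G" "?B \<in> group_center H.S.G"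
    using A BF by (simp_all add: full_congruence_subgroup_def)
  note scalar = H.S.center_iff[OF GG(1), THEN iffD1, OF center(1), rule_format]
    H.S.center_iff[OF GG(2), THEN iffD1, OF center(2), rule_format]
  have off: "?A $$ (i, k) = \<zero>\<^bsub>R Quot I\<^esub>" if "k < n" "k \<noteq> i" for k
    using scalar(1)[of i k] ij that by simp
  have "(?A \<otimes>\<^bsub>H.S.M\<^esub> ?B) $$ (i, i) = ?A $$ (i, i) \<otimes>\<^bsub>R Quot I\<^esub> ?B $$ (i, i)"
    using off GG ij by (intro H.S.scalar_mult_entry H.S.G_M) auto
  then have ab: "(I +> A $$ (i, i)) \<otimes>\<^bsub>R Quot I\<^esub> (I +> B $$ (i, i)) = \<one>\<^bsub>R Quot I\<^esub>"
    using ij AM by (simp add: e H.S.one_entry H.map_mat_entry)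
  have "?B $$ (i, i) = ?B $$ (j, j)"
    using scalar(2)[of i j] ij by (cases "i = j") simp_all
  then have bb: "I +> B $$ (j, j) = I +> B $$ (i, i)"
    using ij AM by (simp add: H.map_mat_entry)
  let ?a = "I +> A $$ (i, i)" and ?b = "I +> B $$ (i, i)"
  have cl: "?a \<in> carrier (R Quot I)" "?b \<in> carrier (R Quot I)" using c ij by auto
  have "I +> (B $$ (j, j) \<otimes> B $$ (i, i) \<otimes> (A $$ (i, i) \<otimes> A $$ (i, i)))
    = ?b \<otimes>\<^bsub>R Quot I\<^esub> ?b \<otimes>\<^bsub>R Quot I\<^esub> (?a \<otimes>\<^bsub>R Quot I\<^esub> ?a)"
    using c ij by (simp add: bb)
  also have "\<dots> = (?a \<otimes>\<^bsub>R Quot I\<^esub> ?b) \<otimes>\<^bsub>R Quot I\<^esub> (?a \<otimes>\<^bsub>R Quot I\<^esub> ?b)"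
    using cl by (simp add: H.S.m_ac)
  also have "\<dots> = I +> \<one>" using ab by simp
  finally show "B $$ (j, j) \<otimes> B $$ (i, i) \<otimes> (A $$ (i, i) \<otimes> A $$ (i, i)) \<ominus> \<one> \<in> I"
    using c ij by (subst quotient_eq_iff_same_a_r_cos[OF I]) auto
qed

text \<open>The normalizer is a stabilizer and asks for equality of \<open>H\<close> with its
  conjugate. Inclusion for all \<open>g \<in> K\<close> suffices, because it can be applied to the
  inverse of \<open>g\<close> as well.\<close>

lemma normalizer_iff:
  assumes "subgroup H G" "subgroup K G"
  shows "K \<subseteq> normalizer G H \<longleftrightarrow> (\<forall>g\<in>K. \<forall>h\<in>H. g \<otimes>\<^bsub>G\<^esub> h \<otimes>\<^bsub>G\<^esub> inv\<^bsub>G\<^esub> g \<in> H)"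
proof -
  interpret G: group G by (rule group_G)
  interpret H: subgroup H G by fact
  interpret K: subgroup K G by fact
  have N: "g \<in> normalizer G H \<longleftrightarrow> g \<in> carrier G \<and> (\<lambda>h. g \<otimes>\<^bsub>G\<^esub> h \<otimes>\<^bsub>G\<^esub> inv\<^bsub>G\<^esub> g) ` H = H" for g
    unfolding normalizer_def stabilizer_def l_coset_def r_coset_def using H.subset by auto
  show ?thesis
  proof
    assume "K \<subseteq> normalizer G H"
    then show "\<forall>g\<in>K. \<forall>h\<in>H. g \<otimes>\<^bsub>G\<^esub> h \<otimes>\<^bsub>G\<^esub> inv\<^bsub>G\<^esub> g \<in> H"
      using N by blast
  next
    assume a: "\<forall>g\<in>K. \<forall>h\<in>H. g \<otimes>\<^bsub>G\<^esub> h \<otimes>\<^bsub>G\<^esub> inv\<^bsub>G\<^esub> g \<in> H"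
    show "K \<subseteq> normalizer G H"
    proof
      fix g assume g: "g \<in> K"
      have "h \<in> (\<lambda>h. g \<otimes>\<^bsub>G\<^esub> h \<otimes>\<^bsub>G\<^esub> inv\<^bsub>G\<^esub> g) ` H" if h: "h \<in> H" for h
      proof
        show "inv\<^bsub>G\<^esub> g \<otimes>\<^bsub>G\<^esub> h \<otimes>\<^bsub>G\<^esub> inv\<^bsub>G\<^esub> (inv\<^bsub>G\<^esub> g) \<in> H"
          using a g h by blast
        show "h = g \<otimes>\<^bsub>G\<^esub> (inv\<^bsub>G\<^esub> g \<otimes>\<^bsub>G\<^esub> h \<otimes>\<^bsub>G\<^esub> inv\<^bsub>G\<^esub> (inv\<^bsub>G\<^esub> g)) \<otimes>\<^bsub>G\<^esub> inv\<^bsub>G\<^esub> g"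
          using g h by (simp add: G.m_assoc) (simp add: G.m_assoc[symmetric])
      qed
      then show "g \<in> normalizer G H"
        unfolding N using a g by auto
    qed
  qed
qed

text \<open>Induction over the generated group. Inverses of generators cause no trouble: the inverse
  of \<open>T i j x\<close> is the generator \<open>T i j (\<ominus> x)\<close>.\<close>

lemma elementary_normalizes:
  assumes "subgroup H G"
    and gen: "\<And>i j x h. \<lbrakk>i < n; j < n; i \<noteq> j; x \<in> carrier R; h \<in> H\<rbrakk>
      \<Longrightarrow> T i j x \<otimes>\<^bsub>G\<^esub> h \<otimes>\<^bsub>G\<^esub> inv\<^bsub>G\<^esub> (T i j x) \<in> H"
  shows "E \<subseteq> normalizer G H"
proof -
  interpret G: group G by (rule group_G)
  interpret H: subgroup H G by fact
  have "g \<in> carrier G \<and> (\<forall>h\<in>H. g \<otimes>\<^bsub>G\<^esub> h \<otimes>\<^bsub>G\<^esub> inv\<^bsub>G\<^esub> g \<in> H)" if "g \<in> E" for g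
    using that unfolding elementary_group_def
  proof (induction rule: generate.induct)
    case one
    then show ?case by auto
  next
    case (incl g)
    then show ?case using gen by (auto intro: transvection_G)
  next
    case (inv g)
    then obtain i j x where "i < n" "j < n" "i \<noteq> j" "x \<in> carrier R" "g = T i j x" by blast
    then show ?case using gen[of i j "\<ominus> x"] by (simp add: transvection_inv transvection_G)
  next
    case (eng g k)
    have "g \<otimes>\<^bsub>G\<^esub> k \<otimes>\<^bsub>G\<^esub> h \<otimes>\<^bsub>G\<^esub> inv\<^bsub>G\<^esub> (g \<otimes>\<^bsub>G\<^esub> k) = g \<otimes>\<^bsub>G\<^esub> (k \<otimes>\<^bsub>G\<^esub> h \<otimes>\<^bsub>G\<^esub> inv\<^bsub>G\<^esub> k) \<otimes>\<^bsub>G\<^esub> inv\<^bsub>G\<^esub> g" if "h \<in> H" for h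
      using eng that by (simp add: G.m_assoc G.inv_mult_group)
    then show ?case using eng by auto
  qed
  then show ?thesis using normalizer_iff[OF assms(1) subgroup_E] by blast
qed

section \<open>The relative elementary group as a normal closure\<close>

lemma normal_in_E_iff:
  "N \<lhd> G\<lparr>carrier := E\<rparr> \<longleftrightarrow>
    subgroup N G \<and> N \<subseteq> E \<and> (\<forall>g\<in>E. \<forall>h\<in>N. g \<otimes>\<^bsub>G\<^esub> h \<otimes>\<^bsub>G\<^esub> inv\<^bsub>G\<^esub> g \<in> N)"
proof -
  interpret G: group G by (rule group_G)
  interpret GE: group "G\<lparr>carrier := E\<rparr>" by (rule subgroup.subgroup_is_group[OF subgroup_E group_G])
  have "subgroup N (G\<lparr>carrier := E\<rparr>) \<longleftrightarrow> subgroup N G \<and> N \<subseteq> E"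
    using G.incl_subgroup[OF subgroup_E] G.subgroup_incl[OF _ subgroup_E] subgroup.subset by fastforce
  then show ?thesis
    unfolding GE.normal_inv_iff by (auto simp: G.m_inv_consistent[OF subgroup_E])
qed

lemma relative_elementary:
  assumes I: "I \<subseteq> carrier R"
  shows "subgroup (relative_elementary_group n R I) G"
    and "\<And>g h. \<lbrakk>g \<in> E; h \<in> relative_elementary_group n R I\<rbrakk>
      \<Longrightarrow> g \<otimes>\<^bsub>G\<^esub> h \<otimes>\<^bsub>G\<^esub> inv\<^bsub>G\<^esub> g \<in> relative_elementary_group n R I"
    and "elementary_group n R I \<subseteq> relative_elementary_group n R I"
proof -
  interpret G: group G by (rule group_G)
  interpret E: subgroup E G by (rule subgroup_E)
  let ?F = "{N. N \<lhd> G\<lparr>carrier := E\<rparr> \<and> elementary_group n R I \<subseteq> N}"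
  have F: "relative_elementary_group n R I = \<Inter>?F"
    by (simp add: relative_elementary_group_def normal_closure_def)
  have "elementary_group n R I \<subseteq> E"
    unfolding elementary_group_def using I by (intro G.mono_generate) blast
  \<comment> \<open>The family of normal subgroups is nonempty, so its intersection is again a
    subgroup.\<close>
  then have EF: "E \<in> ?F"
    unfolding normal_in_E_iff mem_Collect_eq using subgroup_E by auto
  show "subgroup (relative_elementary_group n R I) G"
    unfolding F using EF by (intro G.subgroups_Inter) (auto simp: normal_in_E_iff)
  show "elementary_group n R I \<subseteq> relative_elementary_group n R I"
    unfolding F by blast
  fix g h assume "g \<in> E" "h \<in> relative_elementary_group n R I"
  then show "g \<otimes>\<^bsub>G\<^esub> h \<otimes>\<^bsub>G\<^esub> inv\<^bsub>G\<^esub> g \<in> relative_elementary_group n R I"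
    unfolding F normal_in_E_iff by blast
qed

lemma relative_elementary_least:
  assumes "N \<lhd> G\<lparr>carrier := E\<rparr>" "elementary_group n R I \<subseteq> N"
  shows "relative_elementary_group n R I \<subseteq> N"
  using assms by (auto simp: relative_elementary_group_def normal_closure_def)

end

section \<open>The sandwich for the level ideal\<close>

context E_normalized
begin

text \<open>The \<open>(i, j)\<close> entry of
  \<open>t\<^sub>i\<^sub>j(-1) s t\<^sub>i\<^sub>j(1)\<close> is \<open>s\<^sub>i\<^sub>i -
  s\<^sub>j\<^sub>j + s\<^sub>i\<^sub>j - s\<^sub>j\<^sub>i\<close>, and off-diagonal entries are
  already known to lie in the level.\<close>

lemma diagonal_in_level:
  assumes s: "s \<in> N" and ij: "i < n" "j < n" "i \<noteq> j"
  shows "s $$ (i, i) \<ominus> s $$ (j, j) \<in> level"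
proof -
  interpret L: ideal level R by (rule ideal_level)
  have sM: "s \<in> carrier M" using s by (intro G_M) simp
  note c = mat_memD(4)[OF sM]
  let ?t = "T i j (\<ominus> \<one>) \<otimes>\<^bsub>G\<^esub> s \<otimes>\<^bsub>G\<^esub> T i j \<one>"
  have tM: "T i j (\<ominus> \<one>) \<otimes>\<^bsub>G\<^esub> s \<in> carrier M"
    using s ij by (intro G_M) (simp add: transvection_G)
  have "T i j (\<ominus> \<one>) \<otimes>\<^bsub>G\<^esub> s \<otimes>\<^bsub>G\<^esub> inv\<^bsub>G\<^esub> (T i j (\<ominus> \<one>)) \<in> N"
    using s ij by (intro E_conj transvection_E) auto
  then have tN: "?t \<in> N" using ij by (simp add: transvection_inv)
  have left: "(T i j (\<ominus> \<one>) \<otimes>\<^bsub>M\<^esub> s) $$ (i, k) = s $$ (i, k) \<ominus> s $$ (j, k)" if k: "k < n" for k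
  proof -
    have "(T i j (\<ominus> \<one>) \<otimes>\<^bsub>M\<^esub> s) $$ (i, k) = dot (\<lambda>m. axis i \<one> m \<oplus> axis j (\<ominus> \<one>) m) (\<lambda>m. s $$ (m, k))"
      unfolding mult_entry[OF ij(1) k] using ij k c
      by (intro dot_cong) (auto simp: transvection_def Pi_iff axis_apply)
    then show ?thesis
      using ij k c col_closed[OF sM k]
      by (simp add: dot_add_left dot_axis_left minus_eq l_minus)
  qed
  have "?t $$ (i, j) = (s $$ (i, j) \<ominus> s $$ (j, j)) \<oplus> (s $$ (i, i) \<ominus> s $$ (j, i))"
    unfolding transvection_dyad[OF ij(1,2) one_closed]
    using ij c tM row_closed[OF tM ij(1)]
    by (simp add: G_simps mult_dyad_entry mat_vec_def dot_axis axis_apply left)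
  moreover have "s $$ (i, i) \<ominus> s $$ (j, j)
      = ((s $$ (i, j) \<ominus> s $$ (j, j)) \<oplus> (s $$ (i, i) \<ominus> s $$ (j, i))) \<ominus> s $$ (i, j) \<oplus> s $$ (j, i)"
    using ij c[of i i] c[of i j] c[of j i] c[of j j] by algebra
  moreover have "?t $$ (i, j) \<in> level" "s $$ (i, j) \<in> level" "s $$ (j, i) \<in> level"
    using offdiagonal_in_level tN s ij by auto
  ultimately show ?thesis
    by (simp add: minus_eq L.a_closed L.a_inv_closed)
qed

lemma level_sandwich:
  "relative_elementary_group n R level \<subseteq> N" "N \<subseteq> full_congruence_subgroup n R level"
proof -
  \<comment> \<open>The normal closure is formed inside \<open>E\<close>, so it is compared with
    \<open>N \<inter> E\<close>; \<open>N\<close> itself may be larger than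
    \<open>E\<close>.\<close>
  have "subgroup (N \<inter> E) G"
    by (intro G.subgroups_Inter_pair subgroup_N subgroup_E)
  then have "N \<inter> E \<lhd> G\<lparr>carrier := E\<rparr>"
    unfolding normal_in_E_iff using E_conj by auto
  moreover have "elementary_group n R level \<subseteq> N \<inter> E"
    unfolding elementary_group_def[of n R level] using \<open>subgroup (N \<inter> E) G\<close>
    by (intro G.generate_subgroup_incl) (auto simp: level_def transvection_E)
  ultimately show "relative_elementary_group n R level \<subseteq> N"
    using relative_elementary_least by blast
  show "N \<subseteq> full_congruence_subgroup n R level"
  proof
    fix s assume "s \<in> N"
    then show "s \<in> full_congruence_subgroup n R level"
      using full_congruence_iff[OF ideal_level, of s] offdiagonal_in_level diagonal_in_level by simp
  qed
qed

end

section \<open>Groups between \<open>N\<close> and the full congruence subgroup\<close>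

context E_normalized_over
begin

lemma commutator_with_congruence:
  assumes s: "s \<in> full_congruence_subgroup n R I" and ij: "i < n" "j < n" "i \<noteq> j" and x: "x \<in> carrier R"
  shows "ncong (s \<otimes>\<^bsub>G\<^esub> T i j x \<otimes>\<^bsub>G\<^esub> inv\<^bsub>G\<^esub> s) (T i j x)"
proof -
  let ?B = "inv\<^bsub>G\<^esub> s"
  have sG: "s \<in> carrier G" using s by (simp add: full_congruence_subgroup_def)
  have M: "s \<in> carrier M" "?B \<in> carrier M" using G_M[OF sG] G_M[OF G.inv_closed[OF sG]] by auto
  note inv = full_congruence_inverse[OF ideal_I s ij(1,2)]
  have mI: "\<And>k l. \<lbrakk>k < n; l < n; k \<noteq> l\<rbrakk> \<Longrightarrow> s $$ (k, l) \<in> I"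
    "\<And>k l. \<lbrakk>k < n; l < n; k \<noteq> l\<rbrakk> \<Longrightarrow> ?B $$ (k, l) \<in> I"
    using s inv(1) full_congruence_iff[OF ideal_I sG] full_congruence_iff[OF ideal_I G.inv_closed[OF sG]]
    by auto
  let ?v = "\<lambda>m. s $$ (m, i)" and ?w = "\<lambda>m. ?B $$ (j, m)" and ?u = "\<lambda>m. ?B $$ (i, m)"
  have V: "?u \<in> V" "?v \<in> V" "?w \<in> V"
    using row_closed[OF M(2)] col_closed[OF M(1)] ij by auto
  have e: "dot (\<lambda>m. ?B $$ (k, m)) ?v = (if k = i then \<one> else \<zero>)" if "k < n" for k
    using G.l_inv[OF sG] mult_entry[OF that ij(1), of ?B s] one_entry[OF that ij(1)] by (simp add: G_simps)
  have d: "dot ?u ?v = \<one>" "dot ?w ?v = \<zero>" using e ij by auto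
  have "s \<otimes>\<^bsub>G\<^esub> T i j x \<otimes>\<^bsub>G\<^esub> ?B = dyad (mat_vec s (axis i x)) ?w"
    unfolding transvection_dyad[OF ij(1,2) x] using sG ij x
    by (intro conj_dyad_axis) (auto simp: axis_apply)
  also have "\<dots> = dyad (\<lambda>m. x \<otimes> ?v m) ?w"
    using ij x row_closed[OF M(1)] mat_memD(4)[OF M(1)]
    by (intro dyad_cong) (simp_all add: mat_vec_def dot_axis m_comm)
  finally have eq: "s \<otimes>\<^bsub>G\<^esub> T i j x \<otimes>\<^bsub>G\<^esub> ?B = dyad (\<lambda>m. x \<otimes> ?v m) ?w" .
  show ?thesis
    unfolding eq by (rule dyad_ncong_transvection[OF V d ij x]) (use mI ij inv(2) in auto)
qed

text \<open>If \<open>h t h\<^sup>-\<^sup>1 = k t\<close> with \<open>k \<in> N\<close>, then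
  \<open>t h t\<^sup>-\<^sup>1 = k\<^sup>-\<^sup>1 h\<close>, and this lies in \<open>H\<close>
  because \<open>N \<subseteq> H\<close>.\<close>

lemma between_normalized:
  assumes H: "subgroup H G" "N \<subseteq> H" "H \<subseteq> full_congruence_subgroup n R I"
  shows "E \<subseteq> normalizer G H"
proof (rule elementary_normalizes[OF H(1)])
  fix i j x h assume ij: "i < n" "j < n" "i \<noteq> j" and x: "x \<in> carrier R" and h: "h \<in> H"
  interpret H: subgroup H G by (rule H(1))
  let ?t = "T i j x"
  have t: "?t \<in> E" "?t \<in> carrier G" using ij x by (auto intro: transvection_E transvection_G)
  have "ncong (h \<otimes>\<^bsub>G\<^esub> ?t \<otimes>\<^bsub>G\<^esub> inv\<^bsub>G\<^esub> h) ?t"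
    using commutator_with_congruence[OF _ ij x] h H by auto
  then obtain k where k: "k \<in> N" "h \<otimes>\<^bsub>G\<^esub> ?t \<otimes>\<^bsub>G\<^esub> inv\<^bsub>G\<^esub> h = k \<otimes>\<^bsub>G\<^esub> ?t"
    unfolding ncong_def by auto
  have "k \<otimes>\<^bsub>G\<^esub> (?t \<otimes>\<^bsub>G\<^esub> h) = h \<otimes>\<^bsub>G\<^esub> ?t"
    using k(1) h t by (simp add: G.m_assoc[symmetric] k(2)[symmetric]) (simp add: G.m_assoc)
  then have "?t \<otimes>\<^bsub>G\<^esub> h = inv\<^bsub>G\<^esub> k \<otimes>\<^bsub>G\<^esub> (h \<otimes>\<^bsub>G\<^esub> ?t)"
    using k(1) h t by (simp add: G.inv_solve_left)
  then have "?t \<otimes>\<^bsub>G\<^esub> h \<otimes>\<^bsub>G\<^esub> inv\<^bsub>G\<^esub> ?t = inv\<^bsub>G\<^esub> k \<otimes>\<^bsub>G\<^esub> h"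
    using k(1) h t by (simp add: G.m_assoc)
  then show "?t \<otimes>\<^bsub>G\<^esub> h \<otimes>\<^bsub>G\<^esub> inv\<^bsub>G\<^esub> ?t \<in> H"
    using k(1) h H(2) by auto
qed

end

section \<open>The sandwich theorem\<close>

theorem corollary13:
  fixes R (structure) and n :: nat and H :: "'a mat set"
  assumes "n \<ge> 3"
    and "cring R" and "\<one> \<noteq> \<zero>"
    and "subgroup H (GL n R)"
  shows "elementary_group n R (carrier R) \<subseteq> normalizer (GL n R) H \<longleftrightarrow>
    (\<exists>I. ideal I R \<and> relative_elementary_group n R I \<subseteq> H
        \<and> H \<subseteq> full_congruence_subgroup n R I)"
proof -
  interpret cring_matrix R n
    using assms(2) by (rule cring_matrix.intro)
  show ?thesis
  proof
    assume "E \<subseteq> normalizer G H"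
    then interpret E_normalized R n H
      by (intro E_normalized.intro E_normalized_axioms.intro cring_matrix_axioms assms(1,4))
        (simp add: normalizer_iff[OF assms(4) subgroup_E])
    show "\<exists>I. ideal I R \<and> relative_elementary_group n R I \<subseteq> H \<and> H \<subseteq> full_congruence_subgroup n R I"
      using ideal_level level_sandwich by blast
  next
    assume "\<exists>I. ideal I R \<and> relative_elementary_group n R I \<subseteq> H \<and> H \<subseteq> full_congruence_subgroup n R I"
    then obtain I where I: "ideal I R" "relative_elementary_group n R I \<subseteq> H"
      "H \<subseteq> full_congruence_subgroup n R I" by blast
    have IR: "I \<subseteq> carrier R" using ideal.Icarr[OF I(1)] by blast
    \<comment> \<open>The normalized group is now the relative elementary group; \<open>H\<close> is
      only known to lie above it.\<close>
    interpret E_normalized R n "relative_elementary_group n R I"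
      by (intro E_normalized.intro E_normalized_axioms.intro cring_matrix_axioms assms(1) relative_elementary[OF IR])
    have "T i j x \<in> relative_elementary_group n R I" if "i < n" "j < n" "i \<noteq> j" "x \<in> I" for i j x
    proof -
      have "T i j x \<in> elementary_group n R I"
        unfolding elementary_group_def using that by (intro generate.incl) blast
      then show ?thesis using relative_elementary(3)[OF IR] by blast
    qed
    then interpret E_normalized_over R n "relative_elementary_group n R I" I
      by (intro E_normalized_over.intro E_normalized_over_axioms.intro E_normalized_axioms I(1))
    show "E \<subseteq> normalizer G H"
      using between_normalized[OF assms(4) I(2,3)] .
  qed
qed

end
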